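(* Let $d\ge1$, let $A\subset\mathbb{R}^d$ be a compact set, $B\subset\mathbb{R}^d$ a nonempty open set, $m>0$ an integer and $\gamma>0$ a real number. Then, for any $0\le\mu<m$, there is a constant $c=c(A,B,\gamma,\mu,m)>0$ (not depending on $v$) such that, for every $v:\mathbb{R}^d\to\mathbb{C}$ with $v\in H^m(\mathbb{R}^d)$, supported in $A$, with $|v|_{H^m(\mathbb{R}^d)}\le\gamma$ and $\|\mathcal{F}v\|_{L^\infty(B)}<1$, $$\|v\|_{L^2(\mathbb{R}^d)}\le c\left(\ln\frac{1}{\|\mathcal{F}v\|_{L^\infty(B)}}\right)^{-\mu}.$$
   Context: Fourier transform: $\mathcal{F}v(\xi)=\frac{1}{(2\pi)^d}\int_{\mathbb{R}^d}e^{i\xi x}v(x)\,dx$ for $\xi\in\mathbb{R}^d$, where $\xi x$ is the scalar product. $H^m(\mathbb{R}^d)$ is the standard $L^2$-based Sobolev space of order $m$, with the seminorm $|v|_{H^m(\mathbb{R}^d)}=\Big(\sum_{j=1}^d\big\|\frac{\partial^m v}{(\partial x_j)^m}\big\|_{L^2(\mathbb{R}^d)}^2\Big)^{1/2}$. If $\|\mathcal{F}v\|_{L^\infty(B)}=0$ (which forces $v=0$), the inequality is understood to hold. *)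

theory Defs
  imports "HOL-Analysis.Analysis" "HOL-Probability.Essential_Supremum"
begin

definition square_integrable :: "(real^'d \<Rightarrow> complex) \<Rightarrow> bool" where
  "square_integrable v \<longleftrightarrow>
     v \<in> borel_measurable lebesgue \<and> integrable lebesgue (\<lambda>x. (norm (v x))\<^sup>2)"

definition L2_norm :: "(real^'d \<Rightarrow> complex) \<Rightarrow> real" where
  "L2_norm v = sqrt (\<integral>x. (norm (v x))\<^sup>2 \<partial>lebesgue)"

definition Linfty_norm :: "(real^'d) set \<Rightarrow> (real^'d \<Rightarrow> complex) \<Rightarrow> ennreal" where
  "Linfty_norm B f = esssup (lebesgue_on B) (\<lambda>\<xi>. ennreal (norm (f \<xi>)))"

definition fourier :: "(real^'d \<Rightarrow> complex) \<Rightarrow> real^'d \<Rightarrow> complex" where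
  "fourier v \<xi> =
     1 / (2 * of_real pi) ^ CARD('d) * (\<integral>x. exp (\<i> * of_real (\<xi> \<bullet> x)) * v x \<partial>lebesgue)"

definition partial_deriv :: "'d \<Rightarrow> (real^'d \<Rightarrow> complex) \<Rightarrow> real^'d \<Rightarrow> complex" where
  "partial_deriv j f x = vector_derivative (\<lambda>t. f (x + t *\<^sub>R axis j 1)) (at 0)"

text \<open>Mixed partial derivatives are indexed by the list of the coordinates along which one
  differentiates. For smooth functions the order is irrelevant, so lists of length \<open>k\<close> account
  for exactly the multi-indices of order \<open>k\<close>.\<close>

definition partial_derivs :: "'d list \<Rightarrow> (real^'d \<Rightarrow> complex) \<Rightarrow> real^'d \<Rightarrow> complex" where
  "partial_derivs js f = foldr partial_deriv js f"

text \<open>Total differentiability of every iterated partial derivative makes all of them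
  continuous, hence is the same as being infinitely often continuously differentiable.\<close>

definition test_function :: "(real^'d \<Rightarrow> complex) \<Rightarrow> bool" where
  "test_function \<phi> \<longleftrightarrow>
     (\<forall>js. partial_derivs js \<phi> differentiable_on UNIV) \<and> compact (closure {x. \<phi> x \<noteq> 0})"

definition has_weak_deriv :: "'d list \<Rightarrow> (real^'d \<Rightarrow> complex) \<Rightarrow> (real^'d \<Rightarrow> complex) \<Rightarrow> bool" where
  "has_weak_deriv js v g \<longleftrightarrow>
     square_integrable v \<and> square_integrable g \<and>
     (\<forall>\<phi>. test_function \<phi> \<longrightarrow>
        (\<integral>x. v x * partial_derivs js \<phi> x \<partial>lebesgue)
          = (-1) ^ length js * (\<integral>x. g x * \<phi> x \<partial>lebesgue))"

definition sobolev :: "nat \<Rightarrow> (real^'d \<Rightarrow> complex) set" where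
  "sobolev m = {v. square_integrable v \<and> (\<forall>js. length js \<le> m \<longrightarrow> (\<exists>g. has_weak_deriv js v g))}"

text \<open>A weak derivative is unique up to a null set, so its \<open>L\<^sup>2\<close> norm does not depend on the
  representative chosen.\<close>

definition weak_deriv :: "'d list \<Rightarrow> (real^'d \<Rightarrow> complex) \<Rightarrow> real^'d \<Rightarrow> complex" where
  "weak_deriv js v = (SOME g. has_weak_deriv js v g)"

definition sobolev_seminorm :: "nat \<Rightarrow> (real^'d \<Rightarrow> complex) \<Rightarrow> real" where
  "sobolev_seminorm m v = sqrt (\<Sum>j\<in>UNIV. (L2_norm (weak_deriv (replicate m j) v))\<^sup>2)"

end

theory Submission
  imports Defs "HOL-Real_Asymp.Real_Asymp"
begin

text \<open>The transform \<open>F\<close> of a compactly supported function extends to an entire function of exponential type, so a bound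
\<open>\<epsilon>\<close> for \<open>|F|\<close> on an open set propagates to all frequencies, with a loss that grows with the distance. The
Sobolev seminorm controls the high frequencies. The estimate comes from balancing the two, and the logarithm reflects that
the loss is little more than exponential in the frequency.

\<^bold>\<open>Low frequencies.\<close> Analytic continuation is replaced by Newton's forward difference formula, which here is just the
binomial theorem under the integral sign. A point at distance \<open>r\<close> from a point \<open>b\<close> of the open set is reached from
\<open>b\<close> in \<open>s\<close> equal steps. The differences of order up to \<open>n\<close> only involve points still inside
the set and contribute at most \<open>(1 + 2s)\<^sup>n \<epsilon>\<close>. The differences of higher order contribute a tail of the exponential
series, at most \<open>exp (e R r - n)\<close> times the \<open>L\<^sup>1\<close> norm of \<open>v\<close>, where \<open>R\<close> bounds the support
(\<open>wave_integral_continuation\<close>).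

\<^bold>\<open>High frequencies.\<close> The function is supported inside a cube and is expanded into a Fourier series there, so that only
finite sums occur. The coefficients are values of \<open>F\<close> on a lattice. An \<open>m\<close>-fold derivative
along coordinate \<open>j\<close> multiplies them by the \<open>m\<close>-th power of the \<open>j\<close>-th frequency, up to a factor of
modulus one. Bessel's inequality for the weak derivatives then bounds everything above frequency \<open>N\<close> by the seminorm
times \<open>O(N\<^sup>-\<^sup>m)\<close> (\<open>low_frequency_estimate\<close>). Two ingredients make this rigorous: truncated plane waves are
test functions (\<open>weak_deriv_fourier\<close>), and trigonometric polynomials are dense
(\<open>trig_approximation_L2\<close>).

\<^bold>\<open>Balance.\<close> With \<open>n\<close> proportional to \<open>N + 1\<close> and \<open>s\<close> to its square, the tail terms are absorbed
into the left-hand side, which leaves, for every \<open>N\<close>,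
\<open>\<parallel>v\<parallel>\<^sup>2 \<le> exp (O((N+1) ln (N+2))) \<epsilon>\<^sup>2 + O((N+1)\<^sup>-\<^sup>2\<^sup>m)\<close>
(\<open>L2_norm_smallness_frequency_trade_off\<close>). If \<open>\<epsilon> = 0\<close>, letting \<open>N\<close> tend to infinity gives \<open>v = 0\<close>.
Otherwise put \<open>L = ln (1/\<epsilon>)\<close> and let \<open>N\<close> be the integer part of \<open>L\<^sup>\<mu>\<^sup>/\<^sup>m\<close>. Since \<open>\<mu> < m\<close>, the exponent
\<open>(N+1) ln (N+2)\<close> is of lower order than \<open>L\<close>, and both terms are \<open>O(L\<^sup>-\<^sup>2\<^sup>\<mu>)\<close>.\<close>

section \<open>Smooth functions of one variable\<close>

definition ddt :: "(real \<Rightarrow> 'a::real_normed_vector) \<Rightarrow> real \<Rightarrow> 'a" where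
  "ddt u x = vector_derivative u (at x)"

text \<open>Derivatives are taken off one at a time. All closure properties below then follow by induction on
the number of derivatives from the first-order rules, in place of the Leibniz formula.\<close>

primrec differentiable_times :: "nat \<Rightarrow> (real \<Rightarrow> 'a::real_normed_vector) \<Rightarrow> bool" where
  "differentiable_times 0 u = True"
| "differentiable_times (Suc n) u = ((\<forall>x. u differentiable at x) \<and> differentiable_times n (ddt u))"

definition smooth :: "(real \<Rightarrow> 'a::real_normed_vector) \<Rightarrow> bool" where
  "smooth u \<longleftrightarrow> (\<forall>n. differentiable_times n u)"

lemma ddt_eqI:
  assumes "\<And>x. (u has_vector_derivative u' x) (at x)"
  shows "ddt u = u'"
  using assms by (auto simp: ddt_def fun_eq_iff intro: vector_derivative_at)

lemma differentiable_times_SucI: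
  assumes "\<And>x. (u has_vector_derivative u' x) (at x)" "differentiable_times n u'"
  shows "differentiable_times (Suc n) u"
  using assms ddt_eqI[of u u'] by (auto intro: differentiableI_vector)

lemma differentiable_times_SucD:
  assumes "differentiable_times (Suc n) u"
  shows "(u has_vector_derivative ddt u x) (at x)" "differentiable_times n (ddt u)"
  using assms by (auto simp: ddt_def vector_derivative_works[symmetric])

lemma differentiable_times_mono: "differentiable_times (Suc n) u \<Longrightarrow> differentiable_times n u"
  by (induction n arbitrary: u) auto

declare differentiable_times.simps(2)[simp del]

lemma differentiable_times_const: "differentiable_times n (\<lambda>x. c)"
proof (induction n arbitrary: c)
  case (Suc n)
  then show ?case by (intro differentiable_times_SucI[where u' = "\<lambda>_. 0"]) auto
qed auto

lemma differentiable_times_add: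
  "differentiable_times n u \<Longrightarrow> differentiable_times n w \<Longrightarrow> differentiable_times n (\<lambda>x. u x + w x)"
proof (induction n arbitrary: u w)
  case (Suc n)
  show ?case
    by (rule differentiable_times_SucI[where u' = "\<lambda>x. ddt u x + ddt w x"])
      (rule has_vector_derivative_add Suc differentiable_times_SucD[OF Suc.prems(1)]
        differentiable_times_SucD[OF Suc.prems(2)])+
qed auto

lemma differentiable_times_mult:
  fixes u w :: "real \<Rightarrow> 'a::real_normed_algebra"
  shows "differentiable_times n u \<Longrightarrow> differentiable_times n w \<Longrightarrow>
    differentiable_times n (\<lambda>x. u x * w x)"
proof (induction n arbitrary: u w)
  case (Suc n)
  show ?case
  proof (rule differentiable_times_SucI[where u' = "\<lambda>x. u x * ddt w x + ddt u x * w x"])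
    show "((\<lambda>x. u x * w x) has_vector_derivative u x * ddt w x + ddt u x * w x) (at x)" for x
      using Suc.prems by (intro has_vector_derivative_mult differentiable_times_SucD)
    show "differentiable_times n (\<lambda>x. u x * ddt w x + ddt u x * w x)"
      by (intro differentiable_times_add Suc.IH differentiable_times_SucD(2)[OF Suc.prems(1)]
          differentiable_times_SucD(2)[OF Suc.prems(2)]
          differentiable_times_mono[OF Suc.prems(1)] differentiable_times_mono[OF Suc.prems(2)])
  qed
qed auto

lemma differentiable_times_inverse:
  fixes u :: "real \<Rightarrow> real"
  shows "differentiable_times n u \<Longrightarrow> (\<And>x. u x \<noteq> 0) \<Longrightarrow> differentiable_times n (\<lambda>x. inverse (u x))"
proof (induction n)
  case (Suc n)
  show ?case
  proof (rule differentiable_times_SucI)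
    show "((\<lambda>x. inverse (u x)) has_vector_derivative
        (-1) * (ddt u x * (inverse (u x) * inverse (u x)))) (at x)" for x
      using differentiable_times_SucD(1)[OF Suc.prems(1), of x] Suc.prems(2)[of x]
      unfolding has_real_derivative_iff_has_vector_derivative[symmetric]
      by (auto intro!: derivative_eq_intros)
    show "differentiable_times n (\<lambda>x. (-1) * (ddt u x * (inverse (u x) * inverse (u x))))"
      by (intro differentiable_times_mult differentiable_times_const
          differentiable_times_SucD(2)[OF Suc.prems(1)] Suc.prems(2)
          Suc.IH[OF differentiable_times_mono[OF Suc.prems(1)]])
  qed
qed auto

lemma differentiable_times_affine:
  "differentiable_times n u \<Longrightarrow> differentiable_times n (\<lambda>x::real. u (a * x + b))"
proof (induction n arbitrary: u)
  case (Suc n)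
  show ?case
  proof (rule differentiable_times_SucI)
    show "((\<lambda>x. u (a * x + b)) has_vector_derivative a *\<^sub>R ddt u (a * x + b)) (at x)" for x
    proof -
      have "((\<lambda>x. a * x + b) has_vector_derivative a) (at x)"
        unfolding has_real_derivative_iff_has_vector_derivative[symmetric]
        by (auto intro!: derivative_eq_intros)
      from vector_diff_chain_at[OF this differentiable_times_SucD(1)[OF Suc.prems]]
      show ?thesis by (simp add: o_def)
    qed
    have "differentiable_times k (\<lambda>x. a *\<^sub>R w x)" if "differentiable_times k w" for k and w :: "real \<Rightarrow> 'a"
      using that
    proof (induction k arbitrary: w)
      case (Suc k)
      show ?case
        by (rule differentiable_times_SucI[where u' = "\<lambda>x. a *\<^sub>R ddt w x"])
          (rule bounded_linear.has_vector_derivative[OF bounded_linear_scaleR_right] Suc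
            differentiable_times_SucD[OF Suc.prems])+
    qed auto
    then show "differentiable_times n (\<lambda>x. a *\<^sub>R ddt u (a * x + b))"
      using Suc.IH Suc.prems differentiable_times_SucD by blast
  qed
qed auto

lemma differentiable_times_of_real:
  "differentiable_times n u \<Longrightarrow> differentiable_times n (\<lambda>x. complex_of_real (u x))"
proof (induction n arbitrary: u)
  case (Suc n)
  show ?case
    by (rule differentiable_times_SucI[where u' = "\<lambda>x. complex_of_real (ddt u x)"])
      (rule bounded_linear.has_vector_derivative[OF bounded_linear_of_real] Suc
        differentiable_times_SucD[OF Suc.prems])+
qed auto

lemma has_vector_derivative_exp_line:
  "((\<lambda>x. exp (c * of_real x)) has_vector_derivative c * exp (c * of_real x)) (at x)" for c :: complex
proof -
  have "((\<lambda>z. exp (c * z)) has_field_derivative c * exp (c * of_real x)) (at (of_real x))"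
    by (auto intro!: derivative_eq_intros)
  then show ?thesis by (rule has_vector_derivative_real_field)
qed

lemma differentiable_times_exp_line:
  "differentiable_times n (\<lambda>x. exp (c * complex_of_real x))"
proof (induction n)
  case (Suc n)
  show ?case
    by (rule differentiable_times_SucI[OF has_vector_derivative_exp_line])
      (intro differentiable_times_mult differentiable_times_const Suc)
qed auto

text \<open>The classical flat functions \<open>x\<^sup>-\<^sup>k exp (-1/x)\<close>, extended by zero to \<open>x \<le> 0\<close>. Only
\<open>k = 0\<close> is wanted. The other \<open>k\<close> are there because the derivative of a flat function
is a linear combination of two flat functions, so that the whole family is smooth by a single
induction.\<close>

definition flat :: "nat \<Rightarrow> real \<Rightarrow> real" where
  "flat k x = (if x > 0 then inverse x ^ k * exp (- inverse x) else 0)"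

lemma tendsto_flat_0: "(flat k \<longlongrightarrow> 0) (at 0)"
  unfolding filterlim_at_split
proof
  show "(flat k \<longlongrightarrow> 0) (at_left 0)"
    by (rule tendsto_eventually) (auto simp: flat_def eventually_at_filter)
  have "((\<lambda>x. inverse x ^ k / exp (inverse x)) \<longlongrightarrow> (0::real)) (at_right 0)"
    by (rule filterlim_compose[OF tendsto_power_div_exp_0 filterlim_inverse_at_top_right])
  moreover have "eventually (\<lambda>x. inverse x ^ k / exp (inverse x) = flat k x) (at_right 0)"
    by (auto simp: flat_def exp_minus field_simps eventually_at_filter)
  ultimately show "(flat k \<longlongrightarrow> 0) (at_right 0)"
    using tendsto_cong by force
qed

lemma has_vector_derivative_flat:
  "(flat k has_vector_derivative (flat (k + 2) x + (- real k) * flat (k + 1) x)) (at x)"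
proof -
  consider "x < 0" | "x = 0" | "x > 0" by linarith
  then have "(flat k has_real_derivative (flat (k + 2) x + (- real k) * flat (k + 1) x)) (at x)"
  proof cases
    case 1
    have "((\<lambda>_. 0) has_real_derivative 0) (at x)" by simp
    then have "(flat k has_real_derivative 0) (at x)"
      by (rule has_field_derivative_transform_within_open[of _ _ _ "{..<0}"])
        (use 1 in \<open>auto simp: flat_def\<close>)
    then show ?thesis using 1 by (simp add: flat_def)
  next
    case 2
    have "((\<lambda>y. (flat k y - flat k 0) / (y - 0)) \<longlongrightarrow> 0) (at 0)"
    proof (rule Lim_transform_eventually[OF tendsto_flat_0[of "Suc k"]])
      show "\<forall>\<^sub>F y in at 0. flat (Suc k) y = (flat k y - flat k 0) / (y - 0)"
        by (auto simp: flat_def eventually_at_filter field_simps)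
    qed
    then have "(flat k has_real_derivative 0) (at 0)" unfolding has_field_derivative_iff .
    then show ?thesis using 2 by (simp add: flat_def)
  next
    case 3
    have "((\<lambda>x. inverse x ^ k * exp (- inverse x)) has_real_derivative
        (flat (k + 2) x + (- real k) * flat (k + 1) x)) (at x)"
      using 3 power_eq_if[of x "k - 1"]
      by (cases k)
        (auto intro!: derivative_eq_intros simp: flat_def field_simps power2_eq_square split: if_splits)
    then show ?thesis
      by (rule has_field_derivative_transform_within_open[of _ _ _ "{0<..}"])
        (use 3 in \<open>auto simp: flat_def\<close>)
  qed
  then show ?thesis by (simp add: has_real_derivative_iff_has_vector_derivative)
qed

lemma differentiable_times_flat: "differentiable_times n (flat k)"
proof (induction n arbitrary: k)
  case (Suc n)
  show ?case
    by (rule differentiable_times_SucI[OF has_vector_derivative_flat])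
      (intro differentiable_times_add differentiable_times_mult differentiable_times_const Suc)
qed auto

text \<open>The denominator never vanishes, since \<open>x\<close> and \<open>1 - x\<close> are not both nonpositive. The quotient rises from 0
to 1 on the unit interval.\<close>

definition smooth_step :: "real \<Rightarrow> real" where
  "smooth_step x = flat 0 x * inverse (flat 0 x + flat 0 (1 - x))"

lemma smooth_step_props:
  shows "x \<le> 0 \<Longrightarrow> smooth_step x = 0" "x \<ge> 1 \<Longrightarrow> smooth_step x = 1"
    "0 \<le> smooth_step x" "smooth_step x \<le> 1"
proof -
  have "flat 0 y \<ge> 0" for y by (simp add: flat_def)
  then have "flat 0 x + flat 0 (1 - x) > 0" "flat 0 x \<ge> 0" "flat 0 (1 - x) \<ge> 0"
    by (auto simp: flat_def add_pos_nonneg add_nonneg_pos)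
  then show "0 \<le> smooth_step x" "smooth_step x \<le> 1" by (auto simp: smooth_step_def field_simps)
qed (auto simp: smooth_step_def flat_def)

lemma differentiable_times_smooth_step: "differentiable_times n smooth_step"
proof -
  have "differentiable_times n (\<lambda>x. flat 0 (1 - x))"
    using differentiable_times_affine[OF differentiable_times_flat, of n 0 "-1" 1]
    by (simp add: add.commute)
  moreover have "flat 0 x + flat 0 (1 - x) \<noteq> 0" for x
    by (auto simp: flat_def) (smt (verit) exp_gt_zero)+
  ultimately show ?thesis
    unfolding smooth_step_def[abs_def]
    by (intro differentiable_times_mult differentiable_times_inverse differentiable_times_add
        differentiable_times_flat)
qed

definition cutoff :: "real \<Rightarrow> real \<Rightarrow> real" where
  "cutoff \<rho> x = smooth_step (x + (\<rho> + 1)) * smooth_step ((\<rho> + 1) - x)"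

lemma cutoff_props:
  shows "\<bar>x\<bar> \<le> \<rho> \<Longrightarrow> cutoff \<rho> x = 1" "\<bar>x\<bar> \<ge> \<rho> + 1 \<Longrightarrow> cutoff \<rho> x = 0"
    "0 \<le> cutoff \<rho> x" "cutoff \<rho> x \<le> 1"
  by (auto simp: cutoff_def abs_if smooth_step_props mult_le_one split: if_splits)

lemma differentiable_times_cutoff: "differentiable_times n (cutoff \<rho>)"
  using differentiable_times_mult[OF
      differentiable_times_affine[OF differentiable_times_smooth_step, of n 1 "\<rho> + 1"]
      differentiable_times_affine[OF differentiable_times_smooth_step, of n "-1" "\<rho> + 1"]]
  by (simp add: cutoff_def[abs_def])

text \<open>One coordinate of the test functions that will be paired with the weak derivatives.\<close>

definition cutoff_wave :: "real \<Rightarrow> complex \<Rightarrow> real \<Rightarrow> complex" where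
  "cutoff_wave \<rho> c x = of_real (cutoff \<rho> x) * exp (c * of_real x)"

lemma smooth_cutoff_wave: "smooth (cutoff_wave \<rho> c)"
  unfolding smooth_def cutoff_wave_def[abs_def]
  by (intro allI differentiable_times_mult differentiable_times_of_real differentiable_times_cutoff
      differentiable_times_exp_line)

lemma smooth_has_vector_derivative: "smooth u \<Longrightarrow> (u has_vector_derivative ddt u x) (at x)"
  and smooth_ddt: "smooth u \<Longrightarrow> smooth (ddt u)"
  using differentiable_times_SucD unfolding smooth_def by blast+

text \<open>Where the cutoff is constantly 1, differentiation only multiplies the exponential by \<open>c\<close>.\<close>

lemma iterated_ddt_cutoff_wave:
  assumes "\<bar>x\<bar> < \<rho>"
  shows "(ddt ^^ n) (cutoff_wave \<rho> c) x = c ^ n * exp (c * of_real x)"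
  using assms
proof (induction n arbitrary: x)
  case 0
  then show ?case by (simp add: cutoff_wave_def cutoff_props)
next
  case (Suc n)
  have "((\<lambda>y. c ^ n * exp (c * of_real y)) has_vector_derivative c ^ n * (c * exp (c * of_real x))) (at x)"
    by (rule has_vector_derivative_mult_right has_vector_derivative_exp_line)+
  then have "((ddt ^^ n) (cutoff_wave \<rho> c) has_vector_derivative c ^ n * (c * exp (c * of_real x))) (at x)"
    by (rule has_vector_derivative_transform_within_open[of _ _ _ "{-\<rho><..<\<rho>}"])
      (use Suc in auto)
  from vector_derivative_at[OF this] show ?case
    by (simp add: ddt_def[of "(ddt ^^ n) _"])
qed

section \<open>Testing weak derivatives against truncated plane waves\<close>

definition tensor :: "('d \<Rightarrow> real \<Rightarrow> complex) \<Rightarrow> real^'d \<Rightarrow> complex" where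
  "tensor u x = (\<Prod>i\<in>UNIV. u i (x $ i))"

lemma partial_deriv_tensor:
  fixes u :: "'d::finite \<Rightarrow> real \<Rightarrow> complex"
  assumes "\<And>x. (u j has_vector_derivative u' x) (at x)"
  shows "partial_deriv j (tensor u) = tensor (u(j := u'))"
proof
  fix x :: "real^'d"
  define C where "C = (\<Prod>i\<in>UNIV - {j}. u i (x $ i))"
  have along: "tensor u (x + t *\<^sub>R axis j 1) = u j (x $ j + t) * C" for t
    unfolding tensor_def C_def
    by (subst prod.remove[of _ j]) (auto simp: axis_def intro!: prod.cong)
  have "((\<lambda>t. u j (x $ j + t)) has_vector_derivative u' (x $ j)) (at 0)"
  proof -
    have "((\<lambda>t. x $ j + t) has_vector_derivative 1) (at 0)"
      unfolding has_real_derivative_iff_has_vector_derivative[symmetric]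
      by (auto intro!: derivative_eq_intros)
    from vector_diff_chain_at[OF this, of "u j" "u' (x $ j)"] show ?thesis
      using assms by (simp add: o_def)
  qed
  then have "((\<lambda>t. u j (x $ j + t) * C) has_vector_derivative u' (x $ j) * C) (at 0)"
    by (rule has_vector_derivative_mult_left)
  then have "partial_deriv j (tensor u) x = u' (x $ j) * C"
    unfolding partial_deriv_def along by (rule vector_derivative_at)
  also have "\<dots> = tensor (u(j := u')) x"
    unfolding tensor_def C_def by (subst (2) prod.remove[of _ j]) (auto intro!: prod.cong)
  finally show "partial_deriv j (tensor u) x = tensor (u(j := u')) x" .
qed

text \<open>A partial derivative of a product of functions of one coordinate each is again such a product. This class
of functions is therefore closed under all the derivatives that a test function must possess.\<close>

lemma partial_derivs_tensor_smooth:
  fixes u :: "'d::finite \<Rightarrow> real \<Rightarrow> complex"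
  assumes "\<And>i. smooth (u i)"
  shows "\<exists>w. (\<forall>i. smooth (w i)) \<and> partial_derivs js (tensor u) = tensor w"
proof (induction js)
  case Nil
  then show ?case using assms by (auto simp: partial_derivs_def)
next
  case (Cons j js)
  then obtain w where w: "\<And>i. smooth (w i)" "partial_derivs js (tensor u) = tensor w"
    by blast
  have "partial_derivs (j # js) (tensor u) = tensor (w(j := ddt (w j)))"
    using w(2) partial_deriv_tensor[OF smooth_has_vector_derivative[OF w(1)]]
    by (simp add: partial_derivs_def)
  moreover have "\<forall>i. smooth ((w(j := ddt (w j))) i)"
    using w(1) by (simp add: smooth_ddt)
  ultimately show ?case by blast
qed

lemma partial_derivs_replicate_tensor:
  fixes u :: "'d::finite \<Rightarrow> real \<Rightarrow> complex"
  assumes "smooth (u j)"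
  shows "partial_derivs (replicate m j) (tensor u) = tensor (u(j := (ddt ^^ m) (u j)))"
proof (induction m)
  case 0
  then show ?case by (simp add: partial_derivs_def)
next
  case (Suc m)
  have "smooth ((ddt ^^ m) (u j))"
    by (induction m) (auto intro: smooth_ddt assms)
  then have "partial_deriv j (tensor (u(j := (ddt ^^ m) (u j))))
      = tensor (u(j := ddt ((ddt ^^ m) (u j))))"
    using partial_deriv_tensor[of "u(j := (ddt ^^ m) (u j))" j] smooth_has_vector_derivative
    by fastforce
  then show ?case using Suc by (simp add: partial_derivs_def del: fun_upd_apply)
qed

lemma tensor_differentiable_on:
  fixes u :: "'d::finite \<Rightarrow> real \<Rightarrow> complex"
  assumes "\<And>i. smooth (u i)"
  shows "tensor u differentiable_on UNIV"
proof -
  have "((\<lambda>x. u i (x $ i)) has_derivative (\<lambda>h. (h $ i) *\<^sub>R ddt (u i) (x $ i))) (at x)"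
    for i :: 'd and x
  proof -
    have "(u i has_derivative (\<lambda>h. h *\<^sub>R ddt (u i) (x $ i))) (at (x $ i))"
      using smooth_has_vector_derivative[OF assms] by (simp add: has_vector_derivative_def)
    from has_derivative_compose[of "\<lambda>x. x $ i" "\<lambda>h. h $ i", OF _ this] show ?thesis
      by (simp add: bounded_linear_imp_has_derivative bounded_linear_vec_nth)
  qed
  then show ?thesis
    unfolding tensor_def[abs_def] differentiable_on_def differentiable_def
    by (intro ballI exI, rule has_derivative_prod)
qed

lemma test_function_tensor:
  fixes u :: "'d::finite \<Rightarrow> real \<Rightarrow> complex"
  assumes "\<And>i. smooth (u i)" and "\<And>i t. r \<le> \<bar>t\<bar> \<Longrightarrow> u i t = 0"
  shows "test_function (tensor u)"
  unfolding test_function_def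
proof
  show "\<forall>js. partial_derivs js (tensor u) differentiable_on UNIV"
  proof
    fix js
    obtain w where "\<forall>i. smooth (w i)" "partial_derivs js (tensor u) = tensor w"
      using partial_derivs_tensor_smooth[of u js, OF assms(1)] by blast
    then show "partial_derivs js (tensor u) differentiable_on UNIV"
      by (simp add: tensor_differentiable_on)
  qed
  have "x \<in> cbox (\<chi> i. -r) (\<chi> i. r)" if "tensor u x \<noteq> 0" for x
  proof -
    have "\<bar>x $ i\<bar> < r" for i
      using that assms(2)[of "x $ i" i] by (auto simp: tensor_def not_le[symmetric])
    then have "- r \<le> x $ i \<and> x $ i \<le> r" for i
      using \<open>\<And>i. \<bar>x $ i\<bar> < r\<close>[of i] by linarith
    then show ?thesis by (simp add: mem_box_cart)
  qed
  then have "{x. tensor u x \<noteq> 0} \<subseteq> cbox (\<chi> i. -r) (\<chi> i. r)" by blast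
  then have "bounded {x. tensor u x \<noteq> 0}" by (rule bounded_subset[OF bounded_cbox])
  then show "compact (closure {x. tensor u x \<noteq> 0})" by simp
qed

lemma continuous_imp_lebesgue_measurable:
  "continuous_on UNIV f \<Longrightarrow> f \<in> borel_measurable lebesgue"
  for f :: "'a::euclidean_space \<Rightarrow> 'b::topological_space"
  by (rule measurable_completion) (simp add: borel_measurable_continuous_onI)

abbreviation wave :: "real^'d \<Rightarrow> real^'d \<Rightarrow> complex" where
  "wave \<xi> x \<equiv> exp (\<i> * of_real (\<xi> \<bullet> x))"

lemma wave_measurable: "wave \<xi> \<in> borel_measurable lebesgue"
  by (intro continuous_imp_lebesgue_measurable continuous_intros)

lemma wave_eq_tensor:
  fixes \<xi> x :: "real^'d"
  shows "wave \<xi> x = (\<Prod>i\<in>UNIV. exp (\<i> * of_real (\<xi> $ i) * of_real (x $ i)))"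
  by (simp add: exp_sum[symmetric] inner_vec_def sum_distrib_left mult_ac)

definition cube_cutoff :: "real \<Rightarrow> real^'d \<Rightarrow> real" where
  "cube_cutoff \<rho> x = (\<Prod>i\<in>UNIV. cutoff \<rho> (x $ i))"

lemma cube_cutoff_props:
  fixes x :: "real^'d"
  shows "0 \<le> cube_cutoff \<rho> x" "cube_cutoff \<rho> x \<le> 1"
    "\<rho> + 1 \<le> \<bar>x $ i\<bar> \<Longrightarrow> cube_cutoff \<rho> x = 0"
    "(\<And>i. \<bar>x $ i\<bar> \<le> \<rho>) \<Longrightarrow> cube_cutoff \<rho> x = 1"
  unfolding cube_cutoff_def using cutoff_props(2)[of \<rho> "x $ i"]
  by (auto intro!: prod_nonneg prod_le_1 simp: cutoff_props(1,3,4))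

lemma continuous_on_cube_cutoff: "continuous_on UNIV (cube_cutoff \<rho> :: real^'d \<Rightarrow> real)"
proof -
  have "continuous_on UNIV (cutoff \<rho>)"
    using differentiable_times_SucD(1)[OF differentiable_times_cutoff[of "Suc 0" \<rho>]]
    by (meson continuous_at_imp_continuous_on has_vector_derivative_continuous)
  then have "continuous_on UNIV (\<lambda>x::real^'d. cutoff \<rho> (x $ i))" for i
    by (rule continuous_on_compose2) (auto intro: continuous_intros)
  then show ?thesis
    unfolding cube_cutoff_def[abs_def] by (rule continuous_on_prod)
qed

text \<open>This is the rule that differentiation becomes multiplication by \<open>\<xi>\<^sub>j\<close> on the Fourier
side. A plane wave is not compactly supported, so it is truncated by a cutoff that is 1 near the support
of \<open>v\<close>. On the side of \<open>v\<close> the cutoff is invisible, and on the other side it is kept as a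
factor of \<open>g\<close>, which it makes vanish outside a cube.\<close>

lemma weak_deriv_fourier:
  fixes v g :: "real^'d \<Rightarrow> complex"
  assumes weak: "has_weak_deriv (replicate m j) v g"
    and supp: "AE x in lebesgue. v x \<noteq> 0 \<longrightarrow> (\<forall>i. \<bar>x $ i\<bar> < \<rho>)"
  shows "(\<i> * of_real (\<xi> $ j)) ^ m * (\<integral>x. wave \<xi> x * v x \<partial>lebesgue)
    = (-1) ^ m * (\<integral>x. wave \<xi> x * (of_real (cube_cutoff \<rho> x) * g x) \<partial>lebesgue)"
proof -
  define u where "u i = cutoff_wave \<rho> (\<i> * of_real (\<xi> $ i))" for i
  have smooth: "smooth (u i)" for i by (simp add: u_def smooth_cutoff_wave)
  have "test_function (tensor u)"
    by (rule test_function_tensor[of _ "\<rho> + 1"]) (use smooth in \<open>auto simp: u_def cutoff_wave_def cutoff_props\<close>)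
  with weak have eq: "(\<integral>x. v x * partial_derivs (replicate m j) (tensor u) x \<partial>lebesgue)
      = (-1) ^ m * (\<integral>x. g x * tensor u x \<partial>lebesgue)"
    by (simp add: has_weak_deriv_def)
  have "v \<in> borel_measurable lebesgue"
    using weak by (simp add: has_weak_deriv_def square_integrable_def)
  have "partial_derivs (replicate m j) (tensor u) \<in> borel_measurable lebesgue"
    using partial_derivs_tensor_smooth[of u "replicate m j", OF smooth]
    by (metis tensor_differentiable_on differentiable_imp_continuous_on
        continuous_imp_lebesgue_measurable)
  with \<open>v \<in> _\<close> have measurable: "(\<lambda>x. v x * partial_derivs (replicate m j) (tensor u) x) \<in> borel_measurable lebesgue"
    "(\<lambda>x. (\<i> * of_real (\<xi> $ j)) ^ m * (wave \<xi> x * v x)) \<in> borel_measurable lebesgue"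
    by (auto intro!: borel_measurable_times wave_measurable)
  have tensor_u: "tensor u x = of_real (cube_cutoff \<rho> x) * wave \<xi> x" for x
    by (simp add: tensor_def u_def cutoff_wave_def cube_cutoff_def wave_eq_tensor prod.distrib)
  have "partial_derivs (replicate m j) (tensor u) x = (\<i> * of_real (\<xi> $ j)) ^ m * wave \<xi> x"
    if "\<forall>i. \<bar>x $ i\<bar> < \<rho>" for x
  proof -
    have "partial_derivs (replicate m j) (tensor u) x =
      (ddt ^^ m) (u j) (x $ j) * (\<Prod>i\<in>UNIV - {j}. u i (x $ i))"
      unfolding partial_derivs_replicate_tensor[of u j, OF smooth] tensor_def
      by (subst prod.remove[of _ j]) (auto intro!: prod.cong)
    also have "(ddt ^^ m) (u j) (x $ j) = (\<i> * of_real (\<xi> $ j)) ^ m * u j (x $ j)"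
      using that by (simp add: u_def iterated_ddt_cutoff_wave)
        (simp add: cutoff_wave_def cutoff_props less_imp_le)
    also have "(\<i> * of_real (\<xi> $ j)) ^ m * u j (x $ j) * (\<Prod>i\<in>UNIV - {j}. u i (x $ i))
       = (\<i> * of_real (\<xi> $ j)) ^ m * tensor u x"
      unfolding tensor_def by (subst (2) prod.remove[of _ j]) (auto simp: mult_ac)
    also have "\<dots> = (\<i> * of_real (\<xi> $ j)) ^ m * wave \<xi> x"
      using that by (simp add: tensor_u cube_cutoff_props less_imp_le)
    finally show ?thesis .
  qed
  note on_supp = this
  from supp have "AE x in lebesgue. v x * partial_derivs (replicate m j) (tensor u) x
      = (\<i> * of_real (\<xi> $ j)) ^ m * (wave \<xi> x * v x)"
  proof eventually_elim
    case (elim x)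
    then show ?case by (cases "v x = 0") (simp_all add: on_supp)
  qed
  then have "(\<integral>x. v x * partial_derivs (replicate m j) (tensor u) x \<partial>lebesgue)
      = (\<integral>x. (\<i> * of_real (\<xi> $ j)) ^ m * (wave \<xi> x * v x) \<partial>lebesgue)"
    by (rule integral_cong_AE[OF measurable])
  also have "\<dots> = (\<i> * of_real (\<xi> $ j)) ^ m * (\<integral>x. wave \<xi> x * v x \<partial>lebesgue)"
    by (rule integral_mult_right_zero)
  finally show ?thesis
    unfolding eq tensor_u by (simp add: mult_ac)
qed

section \<open>Propagation of smallness from an open set\<close>

definition wave_integral :: "(real^'d \<Rightarrow> complex) \<Rightarrow> real^'d \<Rightarrow> complex" where
  "wave_integral v \<xi> = (\<integral>x. wave \<xi> x * v x \<partial>lebesgue)"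

lemma integrable_wave_times:
  assumes "integrable lebesgue v"
  shows "integrable lebesgue (\<lambda>x. wave \<xi> x * v x)"
  by (rule Bochner_Integration.integrable_bound[OF assms])
    (use assms wave_measurable in \<open>auto simp: norm_mult intro!: borel_measurable_times\<close>)

lemma norm_exp_i_minus_1_le: "norm (exp (\<i> * of_real t) - 1) \<le> \<bar>t\<bar>"
  using dist_exp_i_1[of t] abs_sin_x_le_abs_x[of "t / 2"] by (simp add: dist_norm)

lemma exp_tail_le:
  fixes t :: real
  assumes "0 \<le> t"
  shows "(\<Sum>k\<in>{n<..s}. t ^ k / fact k) \<le> exp (exp 1 * t - real n)"
proof -
  have "t ^ k / fact k \<le> exp (- real n) * ((exp 1 * t) ^ k / fact k)" if "n < k" for k
  proof -
    \<comment> \<open>A term beyond \<open>n\<close> gains \<open>exp (-n)\<close> when its argument is scaled by \<open>exp 1\<close>.\<close>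
    have "1 \<le> exp (- real n) * exp (real k)"
      using that by (simp add: exp_add[symmetric])
    then have "1 * t ^ k \<le> exp (- real n) * exp (real k) * t ^ k"
      by (rule mult_right_mono) (use assms in simp)
    then show ?thesis
      by (simp add: power_mult_distrib exp_of_nat_mult[symmetric] divide_right_mono mult_ac)
  qed
  then have "(\<Sum>k\<in>{n<..s}. t ^ k / fact k)
      \<le> (\<Sum>k\<in>{n<..s}. exp (- real n) * ((exp 1 * t) ^ k / fact k))"
    by (intro sum_mono) auto
  also have "\<dots> = exp (- real n) * (\<Sum>k\<in>{n<..s}. (exp 1 * t) ^ k / fact k)"
    by (simp add: sum_distrib_left)
  also have "(\<Sum>k\<in>{n<..s}. (exp 1 * t) ^ k / fact k) \<le> exp (exp 1 * t)"
  proof -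
    have "(\<lambda>k. (exp 1 * t) ^ k / fact k) sums exp (exp 1 * t)"
      using exp_converges[of "exp 1 * t"] by (simp add: divide_inverse mult.commute)
    then show ?thesis
      using assms sum_le_suminf[of "\<lambda>k. (exp 1 * t) ^ k / fact k" "{n<..s}"]
      by (simp add: sums_iff)
  qed
  finally show ?thesis by (simp add: exp_diff exp_minus field_simps)
qed

text \<open>With \<open>w\<close> the plane wave of frequency \<open>h\<close>, these are the binomial expansions of \<open>(1 + (w - 1))\<^sup>s\<close> and of
\<open>(w - 1)\<^sup>s\<close>: the Newton forward difference formula for the transform along the progression
\<open>b, b + h, b + 2h, \<dots>\<close>, and the inversion that recovers a difference from the values. The expansion is
exact because the number of steps is a natural number.\<close>

lemma wave_integral_binomial:
  fixes v :: "real^'d \<Rightarrow> complex"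
  assumes "integrable lebesgue v"
  shows "wave_integral v (b + real s *\<^sub>R h)
    = (\<Sum>k\<le>s. of_nat (s choose k) * (\<integral>x. (wave h x - 1) ^ k * (wave b x * v x) \<partial>lebesgue))"
    and "(\<integral>x. (wave h x - 1) ^ s * (wave b x * v x) \<partial>lebesgue)
    = (\<Sum>k\<le>s. of_nat (s choose k) * (-1) ^ (s - k) * wave_integral v (b + real k *\<^sub>R h))"
proof -
  have wave_shift: "wave (b + real k *\<^sub>R h) x = wave h x ^ k * wave b x" for k x
    by (simp add: inner_add_left algebra_simps exp_add exp_of_nat_mult[symmetric])
  have expand: "(wave h x - 1) ^ k * (wave b x * v x)
    = (\<Sum>j\<le>k. of_nat (k choose j) * (-1) ^ (k - j) * (wave (b + real j *\<^sub>R h) x * v x))" for k x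
    unfolding wave_shift diff_conv_add_uminus binomial_ring[of "wave h x" "-1"] sum_distrib_right
    by (simp add: mult_ac)
  have int: "integrable lebesgue (\<lambda>x. (wave h x - 1) ^ k * (wave b x * v x))" for k
    unfolding expand by (intro Bochner_Integration.integrable_sum integrable_mult_right
        integrable_wave_times assms)
  show "(\<integral>x. (wave h x - 1) ^ s * (wave b x * v x) \<partial>lebesgue)
    = (\<Sum>k\<le>s. of_nat (s choose k) * (-1) ^ (s - k) * wave_integral v (b + real k *\<^sub>R h))"
    unfolding expand wave_integral_def
    by (subst Bochner_Integration.integral_sum)
      (simp_all only: integral_mult_right_zero integrable_mult_right integrable_wave_times assms)
  have "wave (b + real s *\<^sub>R h) x * v x
    = (\<Sum>k\<le>s. of_nat (s choose k) * ((wave h x - 1) ^ k * (wave b x * v x)))" for x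
  proof -
    have "wave h x ^ s = (\<Sum>k\<le>s. of_nat (s choose k) * (wave h x - 1) ^ k)"
      using binomial_ring[of "wave h x - 1" 1 s] by simp
    then show ?thesis
      unfolding wave_shift by (simp only: sum_distrib_right mult.assoc)
  qed
  then show "wave_integral v (b + real s *\<^sub>R h)
    = (\<Sum>k\<le>s. of_nat (s choose k) * (\<integral>x. (wave h x - 1) ^ k * (wave b x * v x) \<partial>lebesgue))"
    unfolding wave_integral_def
    by (simp only: Bochner_Integration.integral_sum integral_mult_right_zero integrable_mult_right int)
qed

text \<open>A quantitative form of unique continuation that avoids complex analysis. The point \<open>b + y\<close> is reached from
\<open>b\<close> in \<open>s\<close> steps of length \<open>|y|/s\<close>, so short that the first \<open>n\<close> of them remain in
the ball where the transform is at most \<open>\<epsilon>\<close>. In the Newton expansion of the value at \<open>b + y\<close>,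
a difference of order \<open>k \<le> n\<close> is at most \<open>2\<^sup>k \<epsilon>\<close>. A difference of higher order is small for
another reason: every factor \<open>w - 1\<close> is at most \<open>R |y| / s\<close> on the support of \<open>v\<close>,
so the remaining terms are bounded by a tail of the exponential series of \<open>R |y|\<close>.\<close>

lemma wave_integral_continuation:
  fixes v :: "real^'d \<Rightarrow> complex"
  assumes v: "integrable lebesgue v"
    and supp: "AE x in lebesgue. v x \<noteq> 0 \<longrightarrow> norm x \<le> R"
    and small: "\<And>y. norm y \<le> \<delta> \<Longrightarrow> norm (wave_integral v (b + y)) \<le> \<epsilon>"
    and s: "0 < s" "real n * norm y \<le> real s * \<delta>" and "0 \<le> R" "0 \<le> \<epsilon>"
  shows "norm (wave_integral v (b + y)) \<le>
    (1 + 2 * real s) ^ n * \<epsilon> + exp (exp 1 * (R * norm y) - real n) * (\<integral>x. norm (v x) \<partial>lebesgue)"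
proof -
  define h where "h = (1 / real s) *\<^sub>R y"
  have y: "y = real s *\<^sub>R h" and norm_y: "norm y = real s * norm h"
    using s by (simp_all add: h_def)
  define I where "I k = (\<integral>x. (wave h x - 1) ^ k * (wave b x * v x) \<partial>lebesgue)" for k
  define V where "V = (\<integral>x. norm (v x) \<partial>lebesgue)"
  have "V \<ge> 0" by (simp add: V_def)
  \<comment> \<open>Differences of low order, bounded through the values of the transform near \<open>b\<close>.\<close>
  have head: "of_nat (s choose k) * norm (I k) \<le> of_nat (n choose k) * (2 * real s) ^ k * \<epsilon>"
    if "k \<le> n" "k \<le> s" for k
  proof -
    have "norm (I k) \<le> (\<Sum>j\<le>k. real (k choose j) * \<epsilon>)"
      unfolding I_def wave_integral_binomial(2)[OF v]
    proof (rule sum_norm_le)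
      fix j assume "j \<in> {..k}"
      then have "real j * norm h \<le> real n * norm h"
        using that by (intro mult_right_mono) auto
      also have "\<dots> \<le> \<delta>" using s norm_y by (simp add: mult.left_commute)
      finally show "norm (of_nat (k choose j) * (-1) ^ (k - j) * wave_integral v (b + real j *\<^sub>R h))
          \<le> real (k choose j) * \<epsilon>"
        using small[of "real j *\<^sub>R h"] by (simp add: norm_mult norm_power mult_left_mono)
    qed
    also have "\<dots> = 2 ^ k * \<epsilon>"
      by (simp add: sum_distrib_right[symmetric] of_nat_sum[symmetric] choose_row_sum
          del: of_nat_sum)
    finally have "real (s choose k) * norm (I k) \<le> real s ^ k * (2 ^ k * \<epsilon>)"
      using binomial_le_pow[OF that(2)] \<open>0 \<le> \<epsilon>\<close>
      by (intro mult_mono) (auto simp flip: of_nat_power)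
    also have "\<dots> = 1 * (real s ^ k * (2 ^ k * \<epsilon>))" by simp
    also have "\<dots> \<le> real (n choose k) * (real s ^ k * (2 ^ k * \<epsilon>))"
      using that(1) \<open>0 \<le> \<epsilon>\<close> by (intro mult_right_mono) (auto simp: Suc_leI zero_less_binomial)
    finally show ?thesis by (simp add: power_mult_distrib mult_ac)
  qed
  \<comment> \<open>Differences of high order, bounded through the support of \<open>v\<close>; the factor \<open>s\<^sup>k\<close> from the binomial coefficient cancels.\<close>
  have tail: "of_nat (s choose k) * norm (I k) \<le> (R * norm y) ^ k / fact k * V" for k
  proof -
    have "norm (I k) \<le> (\<integral>x. norm ((wave h x - 1) ^ k * (wave b x * v x)) \<partial>lebesgue)"
      unfolding I_def by (rule integral_norm_bound)
    also have "\<dots> \<le> (\<integral>x. (R * norm h) ^ k * norm (v x) \<partial>lebesgue)"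
    proof (rule integral_mono_AE')
      show "integrable lebesgue (\<lambda>x. (R * norm h) ^ k * norm (v x))" using v by simp
      show "AE x in lebesgue. 0 \<le> (R * norm h) ^ k * norm (v x)" using \<open>0 \<le> R\<close> by simp
      show "AE x in lebesgue. norm ((wave h x - 1) ^ k * (wave b x * v x)) \<le> (R * norm h) ^ k * norm (v x)"
        using supp
      proof eventually_elim
        case (elim x)
        have "norm (wave h x - 1) \<le> R * norm h" if "v x \<noteq> 0"
        proof -
          have "norm (wave h x - 1) \<le> \<bar>h \<bullet> x\<bar>" by (rule norm_exp_i_minus_1_le)
          also have "\<dots> \<le> norm h * norm x" by (rule Cauchy_Schwarz_ineq2)
          also have "\<dots> \<le> norm h * R" using elim that by (intro mult_left_mono) auto
          finally show ?thesis by (simp add: mult.commute)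
        qed
        then show ?case
          by (cases "v x = 0") (simp_all add: norm_mult norm_power power_mono mult_right_mono)
      qed
    qed
    also have "\<dots> = (R * norm h) ^ k * V" by (simp add: V_def)
    finally have "norm (I k) \<le> (R * norm h) ^ k * V" .
    moreover have "real (s choose k) \<le> real s ^ k / fact k"
    proof -
      have "real ((s choose k) * fact k) \<le> real (s ^ k)"
        using binomial_fact_pow by (rule of_nat_mono)
      then show ?thesis by (simp add: pos_le_divide_eq)
    qed
    ultimately have "real (s choose k) * norm (I k) \<le> real s ^ k / fact k * ((R * norm h) ^ k * V)"
      by (intro mult_mono) auto
    then show ?thesis by (simp add: norm_y power_mult_distrib field_simps)
  qed
  have "norm (wave_integral v (b + y)) \<le> (\<Sum>k\<le>s. of_nat (s choose k) * norm (I k))"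
    unfolding y wave_integral_binomial(1)[OF v] I_def
    by (rule sum_norm_le) (simp add: norm_mult)
  also have "\<dots> = (\<Sum>k\<in>{..s} \<inter> {..n}. of_nat (s choose k) * norm (I k))
      + (\<Sum>k\<in>{n<..s}. of_nat (s choose k) * norm (I k))"
    by (subst sum.union_disjoint[symmetric]) (auto intro!: sum.cong)
  also have "\<dots> \<le> (\<Sum>k\<in>{..s} \<inter> {..n}. of_nat (n choose k) * (2 * real s) ^ k * \<epsilon>)
      + (\<Sum>k\<in>{n<..s}. (R * norm y) ^ k / fact k * V)"
    by (intro add_mono sum_mono head tail) auto
  also have "(\<Sum>k\<in>{..s} \<inter> {..n}. of_nat (n choose k) * (2 * real s) ^ k * \<epsilon>)
      \<le> (\<Sum>k\<le>n. of_nat (n choose k) * (2 * real s) ^ k * \<epsilon>)"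
    using \<open>0 \<le> \<epsilon>\<close> by (intro sum_mono2) auto
  also have "\<dots> = (1 + 2 * real s) ^ n * \<epsilon>"
    using binomial_ring[of "2 * real s" 1 n] by (simp add: sum_distrib_right add.commute)
  also have "(\<Sum>k\<in>{n<..s}. (R * norm y) ^ k / fact k * V) \<le> exp (exp 1 * (R * norm y) - real n) * V"
    unfolding sum_distrib_right[symmetric] using \<open>0 \<le> R\<close> \<open>0 \<le> V\<close>
    by (intro mult_right_mono exp_tail_le) auto
  finally show ?thesis by (simp add: V_def)
qed

section \<open>Orthogonal expansions\<close>

definition L2_inner :: "(real^'d \<Rightarrow> complex) \<Rightarrow> (real^'d \<Rightarrow> complex) \<Rightarrow> complex" where
  "L2_inner f g = (\<integral>x. f x * cnj (g x) \<partial>lebesgue)"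

lemma square_integrable_integrable_mult:
  assumes "square_integrable f" "square_integrable g"
  shows "integrable lebesgue (\<lambda>x. f x * cnj (g x))"
proof (rule Bochner_Integration.integrable_bound)
  show "integrable lebesgue (\<lambda>x. (norm (f x))\<^sup>2 + (norm (g x))\<^sup>2)"
    using assms by (simp add: square_integrable_def)
  have "cnj \<in> borel_measurable borel"
    by (intro borel_measurable_continuous_onI continuous_intros)
  then have "(\<lambda>x. cnj (g x)) \<in> borel_measurable lebesgue"
    using assms(2) unfolding square_integrable_def by (metis measurable_compose)
  then show "(\<lambda>x. f x * cnj (g x)) \<in> borel_measurable lebesgue"
    using assms(1) unfolding square_integrable_def by (metis borel_measurable_times)
  have "a * b \<le> a\<^sup>2 + b\<^sup>2" if "0 \<le> a" "0 \<le> b" for a b :: real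
    using sum_squares_bound[of a b] mult_nonneg_nonneg[OF that] by linarith
  then show "AE x in lebesgue. norm (f x * cnj (g x)) \<le> norm ((norm (f x))\<^sup>2 + (norm (g x))\<^sup>2)"
    by (simp add: norm_mult)
qed

lemma L2_inner_self: "L2_inner f f = of_real (\<integral>x. (norm (f x))\<^sup>2 \<partial>lebesgue)"
  by (simp add: L2_inner_def complex_norm_square[symmetric] del: of_real_power)

lemma L2_inner_commute: "L2_inner g f = cnj (L2_inner f g)"
proof -
  have "cnj (L2_inner f g) = (\<integral>x. cnj (f x * cnj (g x)) \<partial>lebesgue)"
    unfolding L2_inner_def by (rule Bochner_Integration.integral_cnj[symmetric])
  then show ?thesis by (simp add: L2_inner_def mult.commute)
qed

lemma square_integrable_sum:
  fixes e :: "'k \<Rightarrow> real^'d \<Rightarrow> complex"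
  assumes "finite K" "\<And>k. k \<in> K \<Longrightarrow> square_integrable (e k)"
  shows "square_integrable (\<lambda>x. \<Sum>k\<in>K. a k * e k x)"
  unfolding square_integrable_def
proof
  show "(\<lambda>x. \<Sum>k\<in>K. a k * e k x) \<in> borel_measurable lebesgue"
    using assms by (intro borel_measurable_sum borel_measurable_times) (auto simp: square_integrable_def)
  have *: "complex_of_real ((norm (\<Sum>k\<in>K. a k * e k x))\<^sup>2)
      = (\<Sum>k\<in>K. \<Sum>l\<in>K. a k * cnj (a l) * (e k x * cnj (e l x)))" for x
    unfolding complex_norm_square by (simp add: cnj_sum sum_product mult_ac)
  have "integrable lebesgue (\<lambda>x. complex_of_real ((norm (\<Sum>k\<in>K. a k * e k x))\<^sup>2))"
    unfolding * using assms
    by (intro Bochner_Integration.integrable_sum integrable_mult_right square_integrable_integrable_mult)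
  then show "integrable lebesgue (\<lambda>x. (norm (\<Sum>k\<in>K. a k * e k x))\<^sup>2)"
    using complex_of_real_integrable_eq by blast
qed

lemma square_integrable_diff:
  assumes "square_integrable f" "square_integrable g"
  shows "square_integrable (\<lambda>x. f x - g x)"
  using square_integrable_sum[of UNIV "\<lambda>b. if b then f else g" "\<lambda>b. if b then 1 else -1"] assms
  by (simp add: UNIV_bool)

text \<open>Completing the square. With \<open>a\<^sub>k\<close> the Fourier coefficients this is Bessel's inequality; with arbitrary
\<open>a\<^sub>k\<close> it bounds the part of \<open>f\<close> missed by the system by the quality of any approximation,
which turns density of the trigonometric polynomials into Parseval's inequality.\<close>

lemma orthogonal_approximation_identity:
  fixes e :: "'k \<Rightarrow> real^'d \<Rightarrow> complex" and a :: "'k \<Rightarrow> complex"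
  assumes K: "finite K" and f: "square_integrable f"
    and e: "\<And>k. k \<in> K \<Longrightarrow> square_integrable (e k)"
    and orth: "\<And>k l. k \<in> K \<Longrightarrow> l \<in> K \<Longrightarrow> L2_inner (e k) (e l) = (if k = l then of_real V else 0)"
    and "0 < V"
  shows "(\<integral>x. (norm (f x - (\<Sum>k\<in>K. a k * e k x)))\<^sup>2 \<partial>lebesgue)
    = (\<integral>x. (norm (f x))\<^sup>2 \<partial>lebesgue) - (\<Sum>k\<in>K. (norm (L2_inner f (e k)))\<^sup>2) / V
      + V * (\<Sum>k\<in>K. (norm (a k - L2_inner f (e k) / V))\<^sup>2)"
proof -
  define c where "c k = L2_inner f (e k)" for k
  define p where "p x = (\<Sum>k\<in>K. a k * e k x)" for x
  note ip = square_integrable_integrable_mult[OF f f] square_integrable_integrable_mult[OF f e]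
    square_integrable_integrable_mult[OF e f] square_integrable_integrable_mult[OF e e]
  have expand: "(f x - p x) * cnj (f x - p x) = f x * cnj (f x) - (\<Sum>k\<in>K. cnj (a k) * (f x * cnj (e k x)))
      - (\<Sum>k\<in>K. a k * (e k x * cnj (f x))) + (\<Sum>k\<in>K. \<Sum>l\<in>K. a k * cnj (a l) * (e k x * cnj (e l x)))" for x
  proof -
    have "(\<Sum>k\<in>K. \<Sum>l\<in>K. a k * cnj (a l) * (e k x * cnj (e l x))) = p x * cnj (p x)"
      unfolding p_def cnj_sum sum_product by (simp add: mult_ac)
    moreover have "(\<Sum>k\<in>K. cnj (a k) * (f x * cnj (e k x))) = f x * cnj (p x)"
      "(\<Sum>k\<in>K. a k * (e k x * cnj (f x))) = p x * cnj (f x)"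
      unfolding p_def cnj_sum sum_distrib_left sum_distrib_right by (simp_all add: mult_ac)
    ultimately show ?thesis by (simp add: algebra_simps)
  qed
  have "L2_inner (\<lambda>x. f x - p x) (\<lambda>x. f x - p x)
     = L2_inner f f - (\<Sum>k\<in>K. cnj (a k) * L2_inner f (e k))
      - (\<Sum>k\<in>K. a k * L2_inner (e k) f) + (\<Sum>k\<in>K. \<Sum>l\<in>K. a k * cnj (a l) * L2_inner (e k) (e l))"
  proof -
    have "(\<integral>x. (\<Sum>k\<in>K. cnj (a k) * (f x * cnj (e k x))) \<partial>lebesgue) = (\<Sum>k\<in>K. cnj (a k) * L2_inner f (e k))"
      and i1: "integrable lebesgue (\<lambda>x. \<Sum>k\<in>K. cnj (a k) * (f x * cnj (e k x)))"
      unfolding L2_inner_def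
      by (simp_all only: Bochner_Integration.integral_sum Bochner_Integration.integrable_sum
          integrable_mult_right integral_mult_right_zero ip)
    moreover have "(\<integral>x. (\<Sum>k\<in>K. a k * (e k x * cnj (f x))) \<partial>lebesgue) = (\<Sum>k\<in>K. a k * L2_inner (e k) f)"
      and i2: "integrable lebesgue (\<lambda>x. \<Sum>k\<in>K. a k * (e k x * cnj (f x)))"
      unfolding L2_inner_def
      by (simp_all only: Bochner_Integration.integral_sum Bochner_Integration.integrable_sum
          integrable_mult_right integral_mult_right_zero ip)
    moreover have "(\<integral>x. (\<Sum>k\<in>K. \<Sum>l\<in>K. a k * cnj (a l) * (e k x * cnj (e l x))) \<partial>lebesgue)
        = (\<Sum>k\<in>K. \<Sum>l\<in>K. a k * cnj (a l) * L2_inner (e k) (e l))"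
      and i3: "integrable lebesgue (\<lambda>x. \<Sum>k\<in>K. \<Sum>l\<in>K. a k * cnj (a l) * (e k x * cnj (e l x)))"
      unfolding L2_inner_def
      by (simp_all only: Bochner_Integration.integral_sum Bochner_Integration.integrable_sum
          integrable_mult_right integral_mult_right_zero ip cong: sum.cong)
    moreover have "L2_inner (\<lambda>x. f x - p x) (\<lambda>x. f x - p x)
      = (\<integral>x. f x * cnj (f x) \<partial>lebesgue) - (\<integral>x. (\<Sum>k\<in>K. cnj (a k) * (f x * cnj (e k x))) \<partial>lebesgue)
       - (\<integral>x. (\<Sum>k\<in>K. a k * (e k x * cnj (f x))) \<partial>lebesgue)
       + (\<integral>x. (\<Sum>k\<in>K. \<Sum>l\<in>K. a k * cnj (a l) * (e k x * cnj (e l x))) \<partial>lebesgue)"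
      unfolding L2_inner_def expand
      by (simp only: Bochner_Integration.integral_add Bochner_Integration.integral_diff
          Bochner_Integration.integrable_add Bochner_Integration.integrable_diff ip i1 i2 i3)
    ultimately show ?thesis by (simp add: L2_inner_def)
  qed
  also have "(\<Sum>k\<in>K. \<Sum>l\<in>K. a k * cnj (a l) * L2_inner (e k) (e l)) = (\<Sum>k\<in>K. a k * cnj (a k) * V)"
    using K by (simp add: orth if_distrib cong: if_cong)
  also have "L2_inner f f - (\<Sum>k\<in>K. cnj (a k) * L2_inner f (e k)) - (\<Sum>k\<in>K. a k * L2_inner (e k) f)
      + (\<Sum>k\<in>K. a k * cnj (a k) * V)
    = L2_inner f f + (\<Sum>k\<in>K. a k * cnj (a k) * V - cnj (a k) * c k - a k * cnj (c k))"
    by (simp add: sum.distrib sum_subtractf c_def L2_inner_commute[of "e _" f])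
  also have "(\<Sum>k\<in>K. a k * cnj (a k) * V - cnj (a k) * c k - a k * cnj (c k))
    = (\<Sum>k\<in>K. V * ((a k - c k / V) * cnj (a k - c k / V)) - c k * cnj (c k) / V)"
    using \<open>0 < V\<close> by (intro sum.cong) (auto simp: field_simps)
  finally have "complex_of_real (\<integral>x. (norm (f x - p x))\<^sup>2 \<partial>lebesgue)
    = of_real ((\<integral>x. (norm (f x))\<^sup>2 \<partial>lebesgue)
      + (\<Sum>k\<in>K. V * (norm (a k - c k / V))\<^sup>2 - (norm (c k))\<^sup>2 / V))"
    unfolding L2_inner_self by (simp add: complex_norm_square del: of_real_power complex_cnj_diff)
  then show ?thesis
    unfolding of_real_eq_iff p_def c_def
    by (simp add: sum_subtractf sum_distrib_left sum_divide_distrib)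
qed

lemma bessel_inequality:
  fixes e :: "'k \<Rightarrow> real^'d \<Rightarrow> complex"
  assumes K: "finite K" and f: "square_integrable f"
    and e: "\<And>k. k \<in> K \<Longrightarrow> square_integrable (e k)"
    and orth: "\<And>k l. k \<in> K \<Longrightarrow> l \<in> K \<Longrightarrow> L2_inner (e k) (e l) = (if k = l then of_real V else 0)"
    and "0 < V"
  shows "(\<Sum>k\<in>K. (norm (L2_inner f (e k)))\<^sup>2) \<le> V * (\<integral>x. (norm (f x))\<^sup>2 \<partial>lebesgue)"
proof -
  have "0 \<le> (\<integral>x. (norm (f x - (\<Sum>k\<in>K. (L2_inner f (e k) / V) * e k x)))\<^sup>2 \<partial>lebesgue)" by simp
  also have "\<dots> = (\<integral>x. (norm (f x))\<^sup>2 \<partial>lebesgue) - (\<Sum>k\<in>K. (norm (L2_inner f (e k)))\<^sup>2) / V"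
    by (subst orthogonal_approximation_identity[OF assms]) simp_all
  finally show ?thesis using \<open>0 < V\<close> by (simp add: field_simps)
qed

section \<open>Fourier modes on a cube\<close>

lemma lborel_integral_tensor:
  fixes u :: "'d::finite \<Rightarrow> real \<Rightarrow> complex"
  assumes u: "\<And>i. integrable lborel (u i)"
  shows "(\<integral>x. tensor u x \<partial>lborel) = (\<Prod>i\<in>UNIV. \<integral>t. u i t \<partial>lborel)"
proof -
  interpret product_sigma_finite "\<lambda>_::real^'d. lborel :: real measure" ..
  define w where "w b = u (axis_index b)" for b :: "real^'d"
  have Basis: "(Basis :: (real^'d) set) = (\<lambda>i. axis i 1) ` UNIV"
    by (auto simp: Basis_vec_def)
  have inj: "inj (\<lambda>i. axis i 1 :: real^'d)"
    by (auto simp: inj_on_def axis_eq_axis)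
  have index: "axis_index (axis i 1 :: real^'d) = i" for i
    by (rule axis_index_axis)
  have "(\<lambda>x. u i (x $ i)) \<in> borel_measurable borel" for i :: 'd
    by (rule measurable_compose[of "\<lambda>x. x $ i"])
      (use borel_measurable_integrable[OF u[of i]] in \<open>auto intro: borel_measurable_continuous_onI continuous_intros\<close>)
  then have meas: "tensor u \<in> borel_measurable borel"
    unfolding tensor_def[abs_def] by (intro borel_measurable_prod)
  have coord: "(\<Sum>b\<in>Basis. f b *\<^sub>R b) $ i = f (axis i 1)" for f and i :: 'd
  proof -
    have "(\<Sum>b\<in>Basis. f b *\<^sub>R b) $ i = (\<Sum>b\<in>Basis. f b *\<^sub>R b) \<bullet> axis i 1"
      by (simp add: inner_axis)
    also have "\<dots> = f (axis i 1)" by (simp add: axis_in_Basis_iff)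
    finally show ?thesis .
  qed
  have "(\<integral>x. tensor u x \<partial>lborel)
     = (\<integral>f. tensor u (\<Sum>b\<in>Basis. f b *\<^sub>R b) \<partial>(\<Pi>\<^sub>M b\<in>Basis. lborel))"
    by (subst lborel_eq, subst integral_distr) (auto simp: meas)
  also have "\<dots> = (\<integral>f. (\<Prod>b\<in>Basis. w b (f b)) \<partial>(\<Pi>\<^sub>M b\<in>Basis. lborel))"
    unfolding tensor_def coord unfolding Basis using inj
    by (simp add: prod.reindex w_def index)
  also have "\<dots> = (\<Prod>b\<in>Basis. \<integral>t. w b t \<partial>lborel)"
    by (rule product_integral_prod) (auto simp: w_def u)
  also have "\<dots> = (\<Prod>i\<in>UNIV. \<integral>t. u i t \<partial>lborel)"
    unfolding Basis using inj by (simp add: prod.reindex w_def index)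
  finally show ?thesis .
qed

definition period_cube :: "real \<Rightarrow> (real^'d) set" where
  "period_cube T = {x. \<forall>i. \<bar>x $ i\<bar> \<le> pi * T}"

definition frequency :: "real \<Rightarrow> ('d \<Rightarrow> int) \<Rightarrow> real^'d" where
  "frequency T k = (\<chi> i. real_of_int (k i) / T)"

text \<open>The modes vanish outside the cube, so that they are square integrable on the whole space and all inner
products can be taken there.\<close>

definition mode :: "real \<Rightarrow> ('d \<Rightarrow> int) \<Rightarrow> real^'d \<Rightarrow> complex" where
  "mode T k x = of_real (indicator (period_cube T) x) * wave (frequency T k) x"

lemma integral_period_exp:
  assumes "0 < T"
  shows "integrable lborel (\<lambda>t. indicator {-pi * T..pi * T} t * exp (\<i> * of_real (of_int n / T) * of_real t) :: complex)"
    and "(\<integral>t. indicator {-pi * T..pi * T} t * exp (\<i> * of_real (of_int n / T) * of_real t) \<partial>lborel)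
      = (if n = 0 then complex_of_real (2 * pi * T) else 0)"
proof -
  define c where "c = \<i> * complex_of_real (of_int n / T)"
  have ind: "indicator S t * z = indicat_real S t *\<^sub>R z" for S :: "real set" and t and z :: complex
    by (simp add: indicator_def)
  have "set_integrable lborel {-pi * T..pi * T} (\<lambda>t. exp (c * of_real t))"
    by (rule borel_integrable_atLeastAtMost') (intro continuous_intros)
  then show "integrable lborel (\<lambda>t. indicator {-pi * T..pi * T} t * exp (\<i> * of_real (of_int n / T) * of_real t) :: complex)"
    by (simp add: set_integrable_def ind c_def)
  have "-pi * T \<le> pi * T" using assms by simp
  show "(\<integral>t. indicator {-pi * T..pi * T} t * exp (\<i> * of_real (of_int n / T) * of_real t) \<partial>lborel)
      = (if n = 0 then complex_of_real (2 * pi * T) else 0)"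
  proof (cases "n = 0")
    case True
    then show ?thesis
    proof -
      have "(\<integral>t. complex_of_real (indicat_real {-pi * T..pi * T} t) \<partial>lborel)
          = complex_of_real (measure lborel {-pi * T..pi * T})"
        by (simp add: integral_of_real)
      also have "\<dots> = complex_of_real (2 * pi * T)"
        using \<open>-pi * T \<le> pi * T\<close> by simp
      also have "(\<lambda>t. complex_of_real (indicat_real {-pi * T..pi * T} t)) =
          (\<lambda>t. indicator {-pi * T..pi * T} t * exp (\<i> * of_real (of_int n / T) * of_real t))"
        using True by (auto simp: fun_eq_iff indicator_def)
      finally show ?thesis using True by simp
    qed
  next
    case False
    then have "c \<noteq> 0" using assms by (simp add: c_def)
    have "((\<lambda>t. exp (c * of_real t) / c) has_vector_derivative exp (c * of_real t)) (at t within S)" for t S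
    proof -
      have "((\<lambda>z. exp (c * z) / c) has_field_derivative exp (c * of_real t)) (at (of_real t))"
        using \<open>c \<noteq> 0\<close> by (auto intro!: derivative_eq_intros)
      from has_vector_derivative_real_field[OF this] show ?thesis
        by (rule has_vector_derivative_at_within)
    qed
    from integral_FTC_Icc[OF \<open>-pi * T \<le> pi * T\<close> this]
    have "(\<integral>t. indicator {-pi * T..pi * T} t *\<^sub>R exp (c * of_real t) \<partial>lborel)
      = exp (c * of_real (pi * T)) / c - exp (c * of_real (- pi * T)) / c"
      by (simp add: continuous_intros)
    also have "exp (c * of_real (pi * T)) = exp (c * of_real (- pi * T))"
    proof -
      have "c * of_real (pi * T) = c * of_real (- pi * T) + 2 * of_int n * of_real pi * \<i>"
        using assms by (simp add: c_def field_simps)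
      moreover have "exp (2 * of_int n * of_real pi * \<i>) = 1"
        using exp_integer_2pi[of "of_int n"] by (simp add: mult_ac)
      ultimately show ?thesis by (simp only: exp_add mult_1_right)
    qed
    finally show ?thesis using False by (simp add: ind c_def)
  qed
qed

lemma mode_eq_tensor:
  fixes k :: "'d::finite \<Rightarrow> int"
  shows "mode T k = tensor (\<lambda>i t. indicator {-pi * T..pi * T} t * exp (\<i> * of_real (of_int (k i) / T) * of_real t))"
proof
  fix x :: "real^'d"
  have "complex_of_real (indicator (period_cube T) x) = (\<Prod>i\<in>UNIV. indicator {-pi * T..pi * T} (x $ i))"
  proof (cases "x \<in> period_cube T")
    case True
    then have "- pi * T \<le> x $ i \<and> x $ i \<le> pi * T" for i
      unfolding period_cube_def mem_Collect_eq by (smt (verit) minus_mult_left)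
    then show ?thesis using True by simp
  next
    case False
    then obtain i where "\<not> \<bar>x $ i\<bar> \<le> pi * T" by (auto simp: period_cube_def)
    then have "x $ i \<notin> {-pi * T..pi * T}" by (auto simp: abs_le_iff)
    then have "(\<Prod>i\<in>UNIV. indicator {-pi * T..pi * T} (x $ i)) = (0::complex)"
      by (intro prod_zero bexI[of _ i]) (auto simp: indicator_def)
    then show ?thesis using False by simp
  qed
  then show "mode T k x = tensor (\<lambda>i t. indicator {-pi * T..pi * T} t * exp (\<i> * of_real (of_int (k i) / T) * of_real t)) x"
    by (simp add: mode_def tensor_def wave_eq_tensor prod.distrib frequency_def)
qed

lemma period_cube_cbox: "period_cube T = cbox (\<chi> i. - pi * T) (\<chi> i. pi * T)"
  by (auto simp: period_cube_def mem_box_cart abs_le_iff) (smt (verit))+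

lemma mode_borel_measurable:
  fixes k :: "'d::finite \<Rightarrow> int"
  shows "mode T k \<in> borel_measurable borel"
proof -
  have [measurable]: "(period_cube T :: (real^'d) set) \<in> sets borel"
    unfolding period_cube_cbox by simp
  have [measurable]: "wave (frequency T k) \<in> borel_measurable borel"
    by (intro borel_measurable_continuous_onI continuous_intros)
  show ?thesis unfolding mode_def[abs_def] by measurable
qed

lemma mode_lebesgue_measurable: "mode T k \<in> borel_measurable lebesgue"
  by (simp add: measurable_completion mode_borel_measurable)

lemma integral_mode:
  fixes k :: "'d::finite \<Rightarrow> int"
  assumes "0 < T"
  shows "(\<integral>x. mode T k x \<partial>lebesgue) = (if k = (\<lambda>_. 0) then of_real ((2 * pi * T) ^ CARD('d)) else 0)"
proof -
  have "(\<integral>x. mode T k x \<partial>lebesgue) = (\<integral>x. mode T k x \<partial>lborel)"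
    by (rule integral_completion) (simp add: mode_borel_measurable)
  also have "\<dots> = (\<Prod>i\<in>UNIV. if k i = 0 then complex_of_real (2 * pi * T) else 0)"
    unfolding mode_eq_tensor by (subst lborel_integral_tensor) (simp_all only: integral_period_exp[OF assms])
  also have "\<dots> = (if k = (\<lambda>_. 0) then of_real ((2 * pi * T) ^ CARD('d)) else 0)"
    by (auto simp: fun_eq_iff)
  finally show ?thesis .
qed

lemma square_integrable_mode: "square_integrable (mode T k)"
  unfolding square_integrable_def
proof
  show "mode T k \<in> borel_measurable lebesgue" by (rule mode_lebesgue_measurable)
  have "integrable lebesgue (indicat_real (period_cube T))"
    unfolding period_cube_cbox using emeasure_lborel_cbox_finite
    by (simp add: integrable_indicator_iff infinity_ennreal_def)
  moreover have "(norm (mode T k x))\<^sup>2 = indicator (period_cube T) x" for x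
    by (simp add: mode_def norm_mult indicator_def)
  ultimately show "integrable lebesgue (\<lambda>x. (norm (mode T k x))\<^sup>2)" by simp
qed

lemma mode_orthogonal:
  fixes k l :: "'d::finite \<Rightarrow> int"
  assumes "0 < T"
  shows "L2_inner (mode T k) (mode T l) = (if k = l then of_real ((2 * pi * T) ^ CARD('d)) else 0)"
proof -
  have "mode T k x * cnj (mode T l x) = mode T (\<lambda>i. k i - l i) x" for x
  proof -
    have "frequency T k - frequency T l = frequency T (\<lambda>i. k i - l i)"
      by (simp add: frequency_def vec_eq_iff diff_divide_distrib)
    then have "frequency T (\<lambda>i. k i - l i) \<bullet> x = frequency T k \<bullet> x - frequency T l \<bullet> x"
      by (metis inner_diff_left)
    then show ?thesis
      by (simp add: mode_def indicator_def exp_cnj exp_diff exp_minus right_diff_distrib divide_inverse)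
  qed
  then show ?thesis
    unfolding L2_inner_def using integral_mode[OF assms, of "\<lambda>i. k i - l i"]
    by (simp add: fun_eq_iff)
qed

section \<open>Density of trigonometric polynomials\<close>

lemma norm_diff_square_le:
  fixes a b c :: "'a::real_normed_vector"
  shows "(norm (a - c))\<^sup>2 \<le> 2 * (norm (a - b))\<^sup>2 + 2 * (norm (b - c))\<^sup>2"
proof -
  have "norm (a - c) \<le> norm (a - b) + norm (b - c)"
    using norm_triangle_ineq[of "a - b" "b - c"] by simp
  then have "(norm (a - c))\<^sup>2 \<le> (norm (a - b) + norm (b - c))\<^sup>2"
    by (rule power_mono) simp
  also have "\<dots> \<le> 2 * (norm (a - b))\<^sup>2 + 2 * (norm (b - c))\<^sup>2"
    using sum_squares_bound[of "norm (a - b)" "norm (b - c)"] by (simp add: power2_sum)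
  finally show ?thesis .
qed

text \<open>A measurable function is an almost everywhere limit of continuous functions. To turn this into \<open>L\<^sup>2\<close>
convergence by dominated convergence, \<open>v\<close> and the approximants are first made bounded by radial
truncation in the complex plane, and the approximants are multiplied by a cutoff that is 1 on the support of
\<open>v\<close>.\<close>

lemma continuous_approximation:
  fixes v :: "real^'d \<Rightarrow> complex"
  assumes v: "square_integrable v"
    and supp: "AE x in lebesgue. v x \<noteq> 0 \<longrightarrow> (\<forall>i. \<bar>x $ i\<bar> < \<rho>)" and "0 < e"
  obtains f where "continuous_on UNIV f" "\<And>x i. \<rho> + 1 \<le> \<bar>x $ i\<bar> \<Longrightarrow> f x = 0"
    "square_integrable f" "(\<integral>x. (norm (v x - f x))\<^sup>2 \<partial>lebesgue) < e"
proof -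
  define cut where "cut n = closest_point (cball (0::complex) (real n))" for n
  have cut_cont: "continuous_on S (cut n)" for n S
    unfolding cut_def by (rule continuous_on_closest_point) auto
  have cut_0: "cut n 0 = 0" for n by (simp add: cut_def closest_point_self)
  have cut_le: "norm (cut n z) \<le> norm z" for n z
    using closest_point_lipschitz[of "cball 0 (real n)" z 0] cut_0[of n] by (simp add: cut_def)
  have cut_n: "norm (cut n z) \<le> real n" for n z
    using closest_point_in_set[of "cball 0 (real n)" z] by (simp add: cut_def)
  have v_meas: "v \<in> borel_measurable lebesgue" and v_int: "integrable lebesgue (\<lambda>x. (norm (v x))\<^sup>2)"
    using v by (simp_all add: square_integrable_def)
  have cut_meas: "(\<lambda>x. cut n (v x)) \<in> borel_measurable lebesgue" for n
    using cut_cont by (rule measurable_compose[OF v_meas borel_measurable_continuous_onI])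
  \<comment> \<open>First limit: the truncations of \<open>v\<close> converge to \<open>v\<close>.\<close>
  have "(\<lambda>n. \<integral>x. (norm (v x - cut n (v x)))\<^sup>2 \<partial>lebesgue) \<longlonglongrightarrow> (\<integral>x. 0 \<partial>(lebesgue :: (real^'d) measure))"
  proof (rule integral_dominated_convergence)
    show "integrable lebesgue (\<lambda>x. 4 * (norm (v x))\<^sup>2)" using v_int by simp
    show "(\<lambda>x. (norm (v x - cut n (v x)))\<^sup>2) \<in> borel_measurable lebesgue" for n
      using v_meas cut_meas by measurable
    have "(\<lambda>n. (norm (v x - cut n (v x)))\<^sup>2) \<longlonglongrightarrow> 0" for x
    proof (rule tendsto_eventually)
      have "\<forall>\<^sub>F n in sequentially. norm (v x) \<le> real n"
        using filterlim_real_sequentially by (simp add: filterlim_at_top)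
      then show "\<forall>\<^sub>F n in sequentially. (norm (v x - cut n (v x)))\<^sup>2 = 0"
        by eventually_elim (simp add: cut_def closest_point_self)
    qed
    then show "AE x in lebesgue. (\<lambda>n. (norm (v x - cut n (v x)))\<^sup>2) \<longlonglongrightarrow> 0" by simp
    have "norm ((norm (z - cut n z))\<^sup>2) \<le> 4 * (norm z)\<^sup>2" for n z
    proof -
      have "norm (z - cut n z) \<le> 2 * norm z"
        using norm_triangle_ineq4[of z "cut n z"] cut_le[of n z] by linarith
      then have "(norm (z - cut n z))\<^sup>2 \<le> (2 * norm z)\<^sup>2" by (rule power_mono) simp
      then show ?thesis by (simp add: power_mult_distrib)
    qed
    then show "AE x in lebesgue. norm ((norm (v x - cut n (v x)))\<^sup>2) \<le> 4 * (norm (v x))\<^sup>2" for n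
      by simp
  qed simp
  then have "\<forall>\<^sub>F n in sequentially. (\<integral>x. (norm (v x - cut n (v x)))\<^sup>2 \<partial>lebesgue) < e / 4"
    using \<open>0 < e\<close> by (intro order_tendstoD(2)[where y = 0]) auto
  then obtain n where n: "(\<integral>x. (norm (v x - cut n (v x)))\<^sup>2 \<partial>lebesgue) < e / 4"
    by (auto simp: eventually_sequentially)
  have "v measurable_on UNIV"
    using v_meas by (simp add: measurable_on_iff_borel_measurable)
  then obtain N g where "negligible N" and g_cont: "\<And>k. continuous_on UNIV (g k)"
    and g_lim: "\<And>x. x \<notin> N \<Longrightarrow> (\<lambda>k. g k x) \<longlonglongrightarrow> v x"
    by (auto simp: measurable_on_def)
  define f where "f k x = of_real (cube_cutoff \<rho> x) * cut n (g k x)" for k x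
  have f_cont: "continuous_on UNIV (f k)" for k
    unfolding f_def
    by (intro continuous_intros continuous_on_compose2[OF cut_cont[of UNIV] g_cont]
        continuous_on_compose2[OF continuous_on_of_real_id continuous_on_cube_cutoff]) auto
  have f_0: "f k x = 0" if "\<rho> + 1 \<le> \<bar>x $ i\<bar>" for k x i
    using that by (simp add: f_def cube_cutoff_props)
  define Q where "Q = (cbox (\<chi> i. - (\<rho> + 1)) (\<chi> i. \<rho> + 1) :: (real^'d) set)"
  have f_le: "norm (f k x) \<le> real n * indicator Q x" for k x
  proof (cases "x \<in> Q")
    case True
    have "norm (f k x) \<le> 1 * real n"
      unfolding f_def norm_mult using cube_cutoff_props(1,2)[of \<rho> x] cut_n by (intro mult_mono) auto
    then show ?thesis using True by simp
  next
    case False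
    then obtain i where "\<not> (- (\<rho> + 1) \<le> x $ i \<and> x $ i \<le> \<rho> + 1)"
      by (auto simp: Q_def mem_box_cart)
    then have "\<rho> + 1 \<le> \<bar>x $ i\<bar>" by linarith
    then have "f k x = 0" by (rule f_0)
    then show ?thesis by simp
  qed
  have Q_int: "integrable lebesgue (\<lambda>x. c * indicat_real Q x)" for c
    unfolding Q_def
    using emeasure_lborel_cbox_finite[of "\<chi> i. - (\<rho> + 1)" "(\<chi> i. \<rho> + 1) :: real^'d"]
    by (simp add: integrable_indicator_iff infinity_ennreal_def)
  have f_meas: "f k \<in> borel_measurable lebesgue" for k
    using f_cont by (rule continuous_imp_lebesgue_measurable)
  have f_sq: "square_integrable (f k)" for k
    unfolding square_integrable_def
  proof
    show "integrable lebesgue (\<lambda>x. (norm (f k x))\<^sup>2)"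
    proof (rule Bochner_Integration.integrable_bound[OF Q_int[of "(real n)\<^sup>2"]])
      show "(\<lambda>x. (norm (f k x))\<^sup>2) \<in> borel_measurable lebesgue"
        using f_meas by measurable
      have "(norm (f k x))\<^sup>2 \<le> (real n)\<^sup>2 * indicat_real Q x" for x
        using power_mono[OF f_le[of k x], of 2] by (cases "x \<in> Q") simp_all
      from order_trans[OF this abs_ge_self]
      show "AE x in lebesgue. norm ((norm (f k x))\<^sup>2) \<le> norm ((real n)\<^sup>2 * indicat_real Q x)"
        unfolding real_norm_def abs_power2 by (rule AE_I2)
    qed
  qed (rule f_meas)
  \<comment> \<open>Second limit: the truncation level is now fixed, so a multiple of the indicator of a cube dominates.\<close>
  have "(\<lambda>k. \<integral>x. (norm (cut n (v x) - f k x))\<^sup>2 \<partial>lebesgue) \<longlonglongrightarrow> (\<integral>x. 0 \<partial>(lebesgue :: (real^'d) measure))"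
  proof (rule integral_dominated_convergence)
    show "integrable lebesgue (\<lambda>x. (2 * real n)\<^sup>2 * indicat_real Q x)" by (rule Q_int)
    show "(\<lambda>x. (norm (cut n (v x) - f k x))\<^sup>2) \<in> borel_measurable lebesgue" for k
      using f_meas cut_meas by measurable
    have "AE x in lebesgue. x \<notin> N"
      using \<open>negligible N\<close> by (simp add: negligible_iff_null_sets AE_not_in)
    then show "AE x in lebesgue. (\<lambda>k. (norm (cut n (v x) - f k x))\<^sup>2) \<longlonglongrightarrow> 0"
      using supp
    proof eventually_elim
      case (elim x)
      have "(\<lambda>k. cut n (g k x)) \<longlonglongrightarrow> cut n (v x)"
        using continuous_on_tendsto_compose[OF cut_cont[of UNIV] g_lim[OF elim(1)]] by simp
      then have "(\<lambda>k. (norm (cut n (v x) - f k x))\<^sup>2)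
          \<longlonglongrightarrow> (norm (cut n (v x) - of_real (cube_cutoff \<rho> x) * cut n (v x)))\<^sup>2"
        unfolding f_def by (intro tendsto_intros)
      moreover have "of_real (cube_cutoff \<rho> x) * cut n (v x) = cut n (v x)"
        using elim(2) cube_cutoff_props(4)[of x \<rho>] by (cases "v x = 0") (auto simp: cut_0 less_imp_le)
      ultimately show ?case by simp
    qed
    show "AE x in lebesgue. norm ((norm (cut n (v x) - f k x))\<^sup>2) \<le> (2 * real n)\<^sup>2 * indicat_real Q x" for k
      using supp
    proof eventually_elim
      case (elim x)
      have "norm (cut n (v x)) \<le> real n * indicator Q x"
      proof (cases "v x = 0")
        case False
        then have "- (\<rho> + 1) \<le> x $ i \<and> x $ i \<le> \<rho> + 1" for i
          using elim by (smt (verit))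
        then have "x \<in> Q" by (simp add: Q_def mem_box_cart)
        then show ?thesis using cut_n by simp
      qed (simp add: cut_0)
      then have "norm (cut n (v x) - f k x) \<le> 2 * real n * indicator Q x"
        using norm_triangle_ineq4[of "cut n (v x)" "f k x"] f_le[of k x] by linarith
      then have "(norm (cut n (v x) - f k x))\<^sup>2 \<le> (2 * real n * indicator Q x)\<^sup>2"
        by (rule power_mono) simp
      then show ?case
        unfolding real_norm_def abs_power2 by (cases "x \<in> Q") simp_all
    qed
  qed simp
  then have "\<forall>\<^sub>F k in sequentially. (\<integral>x. (norm (cut n (v x) - f k x))\<^sup>2 \<partial>lebesgue) < e / 4"
    using \<open>0 < e\<close> by (intro order_tendstoD(2)[where y = 0]) auto
  then obtain k where k: "(\<integral>x. (norm (cut n (v x) - f k x))\<^sup>2 \<partial>lebesgue) < e / 4"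
    by (auto simp: eventually_sequentially)
  have cut_sq: "square_integrable (\<lambda>x. cut n (v x))"
    unfolding square_integrable_def
  proof
    show "integrable lebesgue (\<lambda>x. (norm (cut n (v x)))\<^sup>2)"
    proof (rule Bochner_Integration.integrable_bound[OF v_int])
      show "(\<lambda>x. (norm (cut n (v x)))\<^sup>2) \<in> borel_measurable lebesgue"
        using cut_meas by measurable
      show "AE x in lebesgue. norm ((norm (cut n (v x)))\<^sup>2) \<le> norm ((norm (v x))\<^sup>2)"
        unfolding real_norm_def abs_power2 by (intro AE_I2 power_mono cut_le) simp
    qed
  qed (rule cut_meas)
  have "(\<integral>x. (norm (v x - f k x))\<^sup>2 \<partial>lebesgue)
     \<le> (\<integral>x. 2 * (norm (v x - cut n (v x)))\<^sup>2 + 2 * (norm (cut n (v x) - f k x))\<^sup>2 \<partial>lebesgue)"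
    using square_integrable_diff[OF v f_sq] square_integrable_diff[OF v cut_sq]
      square_integrable_diff[OF cut_sq f_sq]
    by (intro integral_mono norm_diff_square_le) (auto simp: square_integrable_def)
  also have "\<dots> = 2 * (\<integral>x. (norm (v x - cut n (v x)))\<^sup>2 \<partial>lebesgue)
      + 2 * (\<integral>x. (norm (cut n (v x) - f k x))\<^sup>2 \<partial>lebesgue)"
    using square_integrable_diff[OF v cut_sq] square_integrable_diff[OF cut_sq f_sq[of k]]
    by (simp add: square_integrable_def)
  also have "\<dots> < e" using n k by simp
  finally show thesis using that f_cont f_0 f_sq by blast
qed

text \<open>Generating the trigonometric polynomials inductively keeps index sets out of the closure proofs. The
representation as one finite sum is recovered at the end.\<close>

inductive_set trig_polynomials :: "real \<Rightarrow> (real^'d \<Rightarrow> complex) set" for T where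
  trig_wave: "(\<lambda>x. c * wave (frequency T k) x) \<in> trig_polynomials T"
| trig_add: "p \<in> trig_polynomials T \<Longrightarrow> q \<in> trig_polynomials T \<Longrightarrow> (\<lambda>x. p x + q x) \<in> trig_polynomials T"

lemma trig_cong: "p \<in> trig_polynomials T \<Longrightarrow> (\<And>x. p x = q x) \<Longrightarrow> q \<in> trig_polynomials T"
  by (metis ext)

lemma trig_const: "(\<lambda>x. c) \<in> trig_polynomials T"
  by (rule trig_cong[OF trig_wave[of c T "\<lambda>_. 0"]]) (simp add: frequency_def inner_vec_def)

lemma trig_sum: "finite I \<Longrightarrow> (\<And>i. i \<in> I \<Longrightarrow> p i \<in> trig_polynomials T) \<Longrightarrow>
    (\<lambda>x. \<Sum>i\<in>I. p i x) \<in> trig_polynomials T"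
  by (induction I rule: finite_induct) (auto intro: trig_add trig_const)

lemma trig_mult:
  assumes "p \<in> trig_polynomials T" "q \<in> trig_polynomials T"
  shows "(\<lambda>x. p x * q x) \<in> trig_polynomials T"
  using assms
proof (induction)
  case (trig_wave c k)
  from trig_wave.prems show ?case
  proof (induction)
    case (trig_wave c' k')
    have "frequency T (\<lambda>i. k i + k' i) \<bullet> x = frequency T k \<bullet> x + frequency T k' \<bullet> x" for x :: "real^'a"
      by (simp add: inner_add_left[symmetric] frequency_def vec_eq_iff add_divide_distrib plus_vec_def)
    then show ?case
      by (intro trig_cong[OF trig_polynomials.trig_wave[of "c * c'" T "\<lambda>i. k i + k' i"]])
        (simp add: exp_add algebra_simps)
  next
    case (trig_add p q)
    show ?case by (rule trig_cong[OF trig_polynomials.trig_add[OF trig_add.IH]]) (simp add: algebra_simps)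
  qed
next
  case (trig_add p p')
  show ?case
    by (rule trig_cong[OF trig_polynomials.trig_add[OF trig_add.IH(1,2)]])
      (simp_all add: algebra_simps trig_add.prems)
qed

lemma trig_polynomial_as_sum:
  assumes "p \<in> trig_polynomials T"
  shows "\<exists>K a. finite K \<and> (\<forall>x. p x = (\<Sum>k\<in>K. a k * wave (frequency T k) x))"
  using assms
proof (induction)
  case (trig_wave c k)
  show ?case by (intro exI[of _ "{k}"] exI[of _ "\<lambda>_. c"]) simp
next
  case (trig_add p q)
  then obtain K a L b where K: "finite K" "\<And>x. p x = (\<Sum>k\<in>K. a k * wave (frequency T k) x)"
    and L: "finite L" "\<And>x. q x = (\<Sum>k\<in>L. b k * wave (frequency T k) x)"
    by blast
  define a' b' where "a' k = (if k \<in> K then a k else 0)" and "b' k = (if k \<in> L then b k else 0)" for k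
  have "p x = (\<Sum>k\<in>K \<union> L. a' k * wave (frequency T k) x)" for x
    unfolding K(2) a'_def using K(1) L(1) by (intro sum.mono_neutral_cong_left) auto
  moreover have "q x = (\<Sum>k\<in>K \<union> L. b' k * wave (frequency T k) x)" for x
    unfolding L(2) b'_def using K(1) L(1) by (intro sum.mono_neutral_cong_left) auto
  ultimately have "p x + q x = (\<Sum>k\<in>K \<union> L. (a' k + b' k) * wave (frequency T k) x)" for x
    by (simp add: sum.distrib distrib_right)
  then show ?case using K(1) L(1) by (intro exI[of _ "K \<union> L"] exI[of _ "\<lambda>k. a' k + b' k"]) simp
qed

text \<open>The image is the cube with opposite faces identified, realised as a compact subset of \<open>\<complex>\<^sup>d\<close>.\<close>

definition torus_map :: "real \<Rightarrow> real^'d \<Rightarrow> complex^'d" where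
  "torus_map T x = (\<chi> i. exp (\<i> * of_real (x $ i / T)))"

lemma continuous_on_torus_map: "T \<noteq> 0 \<Longrightarrow> continuous_on S (torus_map T)"
  unfolding torus_map_def[abs_def] by (intro continuous_on_vec_lambda continuous_intros) auto

lemma trig_coordinate:
  fixes i :: "'d::finite"
  shows "(\<lambda>x. torus_map T x $ i) \<in> trig_polynomials T"
    and "(\<lambda>x. cnj (torus_map T x $ i)) \<in> trig_polynomials T"
proof -
  have eq: "frequency T (\<lambda>j. if j = i then s else 0) \<bullet> x = of_int s * (x $ i / T)" for x :: "real^'d" and s
  proof -
    have "frequency T (\<lambda>j. if j = i then s else 0) = axis i (of_int s / T)"
      by (simp add: frequency_def vec_eq_iff axis_def)
    then show ?thesis by (simp add: inner_axis' )
  qed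
  show "(\<lambda>x. torus_map T x $ i) \<in> trig_polynomials T"
    by (rule trig_cong[OF trig_wave[of 1 T "\<lambda>j. if j = i then 1 else 0"]])
      (simp only: eq, simp add: torus_map_def)
  show "(\<lambda>x. cnj (torus_map T x $ i)) \<in> trig_polynomials T"
    by (rule trig_cong[OF trig_wave[of 1 T "\<lambda>j. if j = i then -1 else 0"]])
      (simp only: eq, simp add: torus_map_def exp_cnj)
qed

text \<open>A real linear form on \<open>\<complex>\<^sup>d\<close> is a combination of the coordinates and their conjugates, and on
the torus these are plane waves.\<close>

lemma trig_real_polynomial_function:
  fixes h :: "complex^'d \<Rightarrow> real"
  assumes "real_polynomial_function h"
  shows "(\<lambda>x. of_real (h (torus_map T x))) \<in> trig_polynomials T"
  using assms
proof (induction)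
  case (linear h)
  interpret h: bounded_linear h by fact
  have coord: "(\<lambda>x. complex_of_real (torus_map T x \<bullet> b)) \<in> trig_polynomials T"
    if "b \<in> Basis" for b :: "complex^'d"
  proof -
    obtain i u where b: "b = axis i u" using \<open>b \<in> Basis\<close> by (auto simp: Basis_vec_def)
    \<comment> \<open>The inner product on \<open>\<complex>\<close> is \<open>Re (z cnj u)\<close>.\<close>
    have *: "complex_of_real (z \<bullet> u) = (cnj u / 2) * z + (u / 2) * cnj z" for z
      by (simp add: complex_eq_iff inner_complex_def field_simps)
    show ?thesis
      unfolding b inner_axis *
      by (intro trig_add trig_mult trig_const trig_coordinate)
  qed
  have h_sum: "h z = (\<Sum>b\<in>Basis. (z \<bullet> b) * h b)" for z
    using arg_cong[OF euclidean_representation[of z, symmetric], of h] by (simp add: h.sum h.scaleR)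
  show ?case
    unfolding h_sum[of "torus_map T _"] of_real_sum of_real_mult
    by (intro trig_sum trig_mult trig_const coord finite_Basis)
next
  case (const c)
  show ?case by (rule trig_const)
qed (simp_all add: trig_add trig_mult)

lemma torus_map_eq_on_period_cube:
  assumes "0 < T" "x \<in> period_cube T" "y \<in> period_cube T" "torus_map T x = torus_map T y" "x $ i \<noteq> y $ i"
  shows "\<bar>x $ i\<bar> = pi * T" "\<bar>y $ i\<bar> = pi * T"
proof -
  have "exp (\<i> * of_real (x $ i / T)) = exp (\<i> * of_real (y $ i / T))"
    using assms(4) by (simp add: torus_map_def vec_eq_iff)
  then obtain n :: int where "\<i> * complex_of_real (x $ i / T) = \<i> * of_real (y $ i / T) + (of_int (2 * n) * pi) * \<i>"
    unfolding exp_eq by blast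
  then have "x $ i / T = y $ i / T + 2 * of_int n * pi"
    by (simp add: complex_eq_iff)
  then have n: "x $ i = y $ i + 2 * of_int n * (pi * T)"
    using assms(1) by (simp add: field_simps)
  have le: "\<bar>x $ i\<bar> \<le> pi * T" "\<bar>y $ i\<bar> \<le> pi * T" using assms(2,3) by (auto simp: period_cube_def)
  have pos: "0 < pi * T" using assms(1) by simp
  have "n \<noteq> 0" using n assms(5) by auto
  moreover have "n < 2"
  proof (rule ccontr)
    assume "\<not> n < 2"
    then have "2 * (pi * T) \<le> of_int n * (pi * T)" using pos by (intro mult_right_mono) auto
    then show False using n le pos by linarith
  qed
  moreover have "-2 < n"
  proof (rule ccontr)
    assume "\<not> -2 < n"
    then have "of_int n * (pi * T) \<le> -2 * (pi * T)" using pos by (intro mult_right_mono) auto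
    then show False using n le pos by linarith
  qed
  ultimately consider "n = 1" | "n = -1" by linarith
  then have "\<bar>x $ i\<bar> = pi * T \<and> \<bar>y $ i\<bar> = pi * T"
  proof cases
    case 1
    then have "x $ i = y $ i + 2 * (pi * T)" using n by simp
    then show ?thesis using le pos by linarith
  next
    case 2
    then have "x $ i = y $ i - 2 * (pi * T)" using n by simp
    then show ?thesis using le pos by linarith
  qed
  then show "\<bar>x $ i\<bar> = pi * T" "\<bar>y $ i\<bar> = pi * T" by auto
qed

text \<open>A function that vanishes on the boundary of the cube descends to a continuous function on the torus, and the
Stone--Weierstrass theorem applies there. Continuity of the descended function is read off from preimages of closed
sets, which are images of compact sets under the torus map.\<close>

lemma trig_polynomials_uniformly_dense:
  fixes f :: "real^'d \<Rightarrow> complex"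
  assumes "0 < T" and f: "continuous_on UNIV f"
    and boundary: "\<And>x i. pi * T \<le> \<bar>x $ i\<bar> \<Longrightarrow> f x = 0" and "0 < e"
  obtains p where "p \<in> trig_polynomials T" "\<And>x. x \<in> period_cube T \<Longrightarrow> norm (f x - p x) < e"
proof -
  let ?Q = "period_cube T :: (real^'d) set" and ?E = "torus_map T :: real^'d \<Rightarrow> complex^'d"
  define G where "G z = f (SOME x. x \<in> ?Q \<and> ?E x = z)" for z
  have Q: "compact ?Q" unfolding period_cube_cbox by simp
  have G: "G (?E x) = f x" if "x \<in> ?Q" for x
  proof -
    define y where "y = (SOME y. y \<in> ?Q \<and> ?E y = ?E x)"
    have y: "y \<in> ?Q \<and> ?E y = ?E x" unfolding y_def by (rule someI[of _ x]) (use that in simp)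
    have "f y = f x"
    proof (cases "y = x")
      case False
      then obtain i where "y $ i \<noteq> x $ i" by (auto simp: vec_eq_iff)
      then have "\<bar>y $ i\<bar> = pi * T" "\<bar>x $ i\<bar> = pi * T"
        using torus_map_eq_on_period_cube[OF \<open>0 < T\<close>, of y x i] y that by auto
      then show ?thesis using boundary[of y i] boundary[of x i] by simp
    qed simp
    then show ?thesis by (simp add: G_def y_def)
  qed
  have E_compact: "compact (?E ` C)" if "compact C" for C
    using that \<open>0 < T\<close> by (intro compact_continuous_image continuous_on_torus_map) auto
  have "continuous_on (?E ` ?Q) G"
  proof (subst continuous_on_closed_vimage[OF compact_imp_closed[OF E_compact[OF Q]]], intro allI impI)
    fix C :: "complex set" assume "closed C"
    have "G -` C \<inter> ?E ` ?Q = ?E ` (f -` C \<inter> ?Q)" using G by auto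
    moreover have "compact (f -` C \<inter> ?Q)"
    proof (rule closed_Int_compact[OF _ Q])
      show "closed (f -` C)"
        using f \<open>closed C\<close> by (simp add: continuous_on_closed_vimage)
    qed
    ultimately show "closed (G -` C \<inter> ?E ` ?Q)" by (simp add: E_compact compact_imp_closed)
  qed
  from Stone_Weierstrass_polynomial_function[OF E_compact[OF Q] this \<open>0 < e\<close>]
  obtain g where g: "polynomial_function g" "\<And>z. z \<in> ?E ` ?Q \<Longrightarrow> norm (G z - g z) < e" by blast
  have "real_polynomial_function (\<lambda>z. Re (g z))" "real_polynomial_function (\<lambda>z. Im (g z))"
    using g(1) bounded_linear_Re bounded_linear_Im by (auto simp: polynomial_function_def o_def)
  note parts = this[THEN trig_real_polynomial_function, of T]
  have "(\<lambda>x. of_real (Re (g (?E x))) + \<i> * of_real (Im (g (?E x)))) \<in> trig_polynomials T"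
    by (intro trig_add trig_mult trig_const parts)
  then have "(\<lambda>x. g (?E x)) \<in> trig_polynomials T"
    by (rule trig_cong) (simp add: complex_eq_iff)
  moreover have "norm (f x - g (?E x)) < e" if "x \<in> ?Q" for x
    using g(2)[of "?E x"] that by (simp add: G)
  ultimately show thesis using that by blast
qed

section \<open>Control of the high frequencies by the Sobolev seminorm\<close>

lemma trig_approximation_L2:
  fixes v :: "real^'d \<Rightarrow> complex"
  assumes "0 < T" "\<rho> + 1 \<le> pi * T" and v: "square_integrable v"
    and supp: "AE x in lebesgue. v x \<noteq> 0 \<longrightarrow> (\<forall>i. \<bar>x $ i\<bar> < \<rho>)" and "0 < e"
  obtains K a where "finite K" "(\<integral>x. (norm (v x - (\<Sum>k\<in>K. a k * mode T k x)))\<^sup>2 \<partial>lebesgue) < e"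
proof -
  let ?Q = "period_cube T :: (real^'d) set"
  obtain f where f: "continuous_on UNIV f" "\<And>x i. \<rho> + 1 \<le> \<bar>x $ i\<bar> \<Longrightarrow> f x = 0"
    "square_integrable f" "(\<integral>x. (norm (v x - f x))\<^sup>2 \<partial>lebesgue) < e / 4"
    using continuous_approximation[OF v supp, of "e / 4"] \<open>0 < e\<close> by auto
  define W where "W = (\<integral>x. indicat_real ?Q x \<partial>lebesgue)"
  have "0 \<le> W" by (simp add: W_def)
  have Q_int: "integrable lebesgue (indicat_real ?Q)"
  proof -
    have "(norm (mode T (\<lambda>_. 0) x))\<^sup>2 = indicat_real ?Q x" for x :: "real^'d"
      by (simp add: mode_def norm_mult indicator_def)
    then show ?thesis
      using square_integrable_mode[of T "\<lambda>_::'d. 0"] by (simp add: square_integrable_def)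
  qed
  define \<eta> where "\<eta> = sqrt (e / (4 * (W + 1)))"
  have "0 < \<eta>" and \<eta>2: "\<eta>\<^sup>2 = e / (4 * (W + 1))"
    using \<open>0 < e\<close> \<open>0 \<le> W\<close> by (simp_all add: \<eta>_def)
  have "\<eta>\<^sup>2 * W \<le> \<eta>\<^sup>2 * (W + 1)" using \<open>0 \<le> W\<close> by (intro mult_left_mono) auto
  also have "\<dots> = e / 4" using \<open>0 \<le> W\<close> by (simp add: \<eta>2 field_simps)
  finally have \<eta>W: "\<eta>\<^sup>2 * W \<le> e / 4" .
  have f_boundary: "f x = 0" if "pi * T \<le> \<bar>x $ i\<bar>" for x i
    using f(2)[of x i] that \<open>\<rho> + 1 \<le> pi * T\<close> by linarith
  obtain p where p: "p \<in> trig_polynomials T" "\<And>x. x \<in> ?Q \<Longrightarrow> norm (f x - p x) < \<eta>"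
    by (rule trig_polynomials_uniformly_dense[OF \<open>0 < T\<close> f(1) f_boundary \<open>0 < \<eta>\<close>]) (assumption | blast)+
  obtain K a where K: "finite K" "\<And>x. p x = (\<Sum>k\<in>K. a k * wave (frequency T k) x)"
    using trig_polynomial_as_sum[OF p(1)] by blast
  define q where "q x = (\<Sum>k\<in>K. a k * mode T k x)" for x
  have q: "q x = of_real (indicator ?Q x) * p x" for x
    by (simp add: q_def K(2) mode_def sum_distrib_left mult_ac)
  have q_sq: "square_integrable q"
    unfolding q_def by (intro square_integrable_sum K square_integrable_mode)
  have fq: "(norm (f x - q x))\<^sup>2 \<le> \<eta>\<^sup>2 * indicat_real ?Q x" for x
  proof (cases "x \<in> ?Q")
    case True
    then show ?thesis using p(2)[OF True] by (simp add: q power_mono)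
  next
    case False
    then obtain i where "pi * T < \<bar>x $ i\<bar>" by (auto simp: period_cube_def not_le)
    then have "pi * T \<le> \<bar>x $ i\<bar>" by (rule less_imp_le)
    then show ?thesis using False f_boundary by (simp add: q)
  qed
  have int: "integrable lebesgue (\<lambda>x. (norm (v x - q x))\<^sup>2)" "integrable lebesgue (\<lambda>x. (norm (v x - f x))\<^sup>2)"
    "integrable lebesgue (\<lambda>x. (norm (f x - q x))\<^sup>2)"
    using square_integrable_diff[OF v q_sq] square_integrable_diff[OF v f(3)]
      square_integrable_diff[OF f(3) q_sq] by (simp_all add: square_integrable_def)
  have "(\<integral>x. (norm (v x - q x))\<^sup>2 \<partial>lebesgue)
     \<le> (\<integral>x. 2 * (norm (v x - f x))\<^sup>2 + 2 * (norm (f x - q x))\<^sup>2 \<partial>lebesgue)"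
    by (intro integral_mono norm_diff_square_le Bochner_Integration.integrable_add integrable_mult_right int)
  also have "\<dots> = 2 * (\<integral>x. (norm (v x - f x))\<^sup>2 \<partial>lebesgue) + 2 * (\<integral>x. (norm (f x - q x))\<^sup>2 \<partial>lebesgue)"
    by (simp add: int)
  also have "(\<integral>x. (norm (f x - q x))\<^sup>2 \<partial>lebesgue) \<le> (\<integral>x. \<eta>\<^sup>2 * indicat_real ?Q x \<partial>lebesgue)"
    by (intro integral_mono fq int integrable_mult_right Q_int)
  also have "\<dots> = \<eta>\<^sup>2 * W" by (simp add: W_def)
  finally have "(\<integral>x. (norm (v x - q x))\<^sup>2 \<partial>lebesgue) < e" using f(4) \<eta>W by linarith
  then show thesis using that K(1) by (simp add: q_def)
qed

lemma L2_inner_mode: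
  fixes w :: "real^'d \<Rightarrow> complex"
  assumes w: "w \<in> borel_measurable lebesgue"
    and "AE x in lebesgue. x \<notin> period_cube T \<longrightarrow> w x = 0"
  shows "L2_inner w (mode T k) = wave_integral w (- frequency T k)"
proof -
  have "cnj \<in> borel_measurable borel"
    by (intro borel_measurable_continuous_onI continuous_intros)
  then have cm: "(\<lambda>x. cnj (mode T k x)) \<in> borel_measurable lebesgue"
    by (rule measurable_compose[OF mode_lebesgue_measurable])
  have "AE x in lebesgue. w x * cnj (mode T k x) = wave (- frequency T k) x * w x"
    using assms(2) by eventually_elim (auto simp: mode_def exp_cnj)
  then show ?thesis
    unfolding L2_inner_def wave_integral_def
    by (intro integral_cong_AE borel_measurable_times w cm wave_measurable)
qed

definition low_modes :: "nat \<Rightarrow> ('d \<Rightarrow> int) set" where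
  "low_modes N = {k. \<forall>i. \<bar>k i\<bar> \<le> int N}"

lemma low_modes_finite_card:
  shows "finite (low_modes N :: ('d::finite \<Rightarrow> int) set)"
    and "card (low_modes N :: ('d \<Rightarrow> int) set) = (2 * N + 1) ^ CARD('d)"
proof -
  have eq: "low_modes N = (UNIV :: 'd set) \<rightarrow>\<^sub>E {- int N..int N}"
    by (auto simp: low_modes_def PiE_def Pi_def abs_le_iff extensional_def) (smt (verit))+
  show "finite (low_modes N :: ('d \<Rightarrow> int) set)" unfolding eq by (rule finite_PiE) auto
  show "card (low_modes N :: ('d \<Rightarrow> int) set) = (2 * N + 1) ^ CARD('d)"
  proof -
    have "nat (int N - - int N + 1) = 2 * N + 1" by linarith
    then show ?thesis unfolding eq by (simp only: card_PiE[OF finite] card_atLeastAtMost_int prod_constant)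
  qed
qed

lemma coefficient_of_weak_deriv:
  fixes v g :: "real^'d \<Rightarrow> complex"
  assumes T: "\<rho> + 1 \<le> pi * T"
    and weak: "has_weak_deriv (replicate m j) v g"
    and supp: "AE x in lebesgue. v x \<noteq> 0 \<longrightarrow> (\<forall>i. \<bar>x $ i\<bar> < \<rho>)"
  shows "(frequency T k $ j) ^ (2 * m) * (norm (L2_inner v (mode T k)))\<^sup>2
    = (norm (L2_inner (\<lambda>x. of_real (cube_cutoff \<rho> x) * g x) (mode T k)))\<^sup>2"
proof -
  have v: "v \<in> borel_measurable lebesgue" and g: "g \<in> borel_measurable lebesgue"
    using weak by (auto simp: has_weak_deriv_def square_integrable_def)
  have out: "\<exists>i. pi * T < \<bar>x $ i\<bar>" if "x \<notin> period_cube T" for x :: "real^'d"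
    using that by (auto simp: period_cube_def not_le)
  have cg: "(\<lambda>x. of_real (cube_cutoff \<rho> x) * g x) \<in> borel_measurable lebesgue"
    using g continuous_imp_lebesgue_measurable[OF continuous_on_cube_cutoff[of \<rho>]] by measurable
  have 1: "L2_inner (\<lambda>x. of_real (cube_cutoff \<rho> x) * g x) (mode T k)
      = wave_integral (\<lambda>x. of_real (cube_cutoff \<rho> x) * g x) (- frequency T k)"
  proof (rule L2_inner_mode[OF cg], rule AE_I2, rule impI)
    fix x :: "real^'d" assume "x \<notin> period_cube T"
    then obtain i where "pi * T < \<bar>x $ i\<bar>" using out[of x] by blast
    then have "\<rho> + 1 \<le> \<bar>x $ i\<bar>" using T by linarith
    then show "of_real (cube_cutoff \<rho> x) * g x = 0" by (simp add: cube_cutoff_props)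
  qed
  have "AE x in lebesgue. x \<notin> period_cube T \<longrightarrow> v x = 0"
    using supp
  proof eventually_elim
    case (elim x)
    have "\<rho> \<le> pi * T" using T by simp
    with elim show ?case using out[of x] by (meson less_le_trans less_asym)
  qed
  from L2_inner_mode[OF v this] have 2: "L2_inner v (mode T k) = wave_integral v (- frequency T k)" .
  have "(\<i> * of_real ((- frequency T k) $ j)) ^ m * wave_integral v (- frequency T k)
      = (-1) ^ m * wave_integral (\<lambda>x. of_real (cube_cutoff \<rho> x) * g x) (- frequency T k)"
    unfolding wave_integral_def by (rule weak_deriv_fourier[OF weak supp])
  from arg_cong[OF this, of norm]
  have "\<bar>frequency T k $ j\<bar> ^ m * norm (L2_inner v (mode T k))
     = norm (L2_inner (\<lambda>x. of_real (cube_cutoff \<rho> x) * g x) (mode T k))"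
    unfolding 1 2 by (simp add: norm_mult norm_power)
  from arg_cong[OF this, of "\<lambda>t. t\<^sup>2"] show ?thesis
    by (simp add: power_mult_distrib power_mult[symmetric] mult.commute[of m 2] power_even_abs)
qed

text \<open>Parseval's inequality for \<open>v\<close>, with the modes split at frequency \<open>N\<close>. A high mode has an index
\<open>k\<close> with \<open>|k\<^sub>j| \<ge> N + 1\<close> for some \<open>j\<close>, so its coefficient is at most
\<open>(T/(N+1))\<^sup>m\<close> times the corresponding coefficient of the truncated \<open>m\<close>-th weak derivative
along \<open>j\<close>. Those coefficients are square summable by Bessel's inequality, and the truncation does not
increase the \<open>L\<^sup>2\<close> norm.\<close>

lemma low_frequency_estimate:
  fixes v :: "real^'d \<Rightarrow> complex"
  assumes "0 < T" "\<rho> + 1 \<le> pi * T" and v: "v \<in> sobolev m"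
    and supp: "AE x in lebesgue. v x \<noteq> 0 \<longrightarrow> (\<forall>i. \<bar>x $ i\<bar> < \<rho>)"
  shows "(L2_norm v)\<^sup>2
    \<le> (\<Sum>k\<in>low_modes N. (norm (wave_integral v (- frequency T k)))\<^sup>2) / (2 * pi * T) ^ CARD('d)
      + (T / (real N + 1)) ^ (2 * m) * (sobolev_seminorm m v)\<^sup>2"
proof -
  define V where "V = (2 * pi * T) ^ CARD('d)"
  have "0 < V" using \<open>0 < T\<close> by (simp add: V_def)
  define c where "c k = L2_inner v (mode T k)" for k
  define g where "g j = weak_deriv (replicate m j) v" for j
  define \<tau> where "\<tau> = (T / (real N + 1)) ^ (2 * m)"
  have v_sq: "square_integrable v" using v by (simp add: sobolev_def)
  have weak: "has_weak_deriv (replicate m j) v (g j)" for j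
  proof -
    have "\<exists>w. has_weak_deriv (replicate m j) v w" using v by (auto simp: sobolev_def)
    then show ?thesis unfolding g_def weak_deriv_def by (rule someI_ex)
  qed
  have orth: "L2_inner (mode T k) (mode T l) = (if k = l then of_real V else 0)" for k l :: "'d \<Rightarrow> int"
    unfolding V_def by (rule mode_orthogonal[OF \<open>0 < T\<close>])
  have L2: "(L2_norm f)\<^sup>2 = (\<integral>x. (norm (f x))\<^sup>2 \<partial>lebesgue)" for f :: "real^'d \<Rightarrow> complex"
    by (simp add: L2_norm_def)
  define h where "h j = (\<lambda>x. of_real (cube_cutoff \<rho> x) * g j x)" for j
  have h_sq: "square_integrable (h j)" and h_le: "(\<integral>x. (norm (h j x))\<^sup>2 \<partial>lebesgue) \<le> (L2_norm (g j))\<^sup>2" for j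
  proof -
    have g_meas: "g j \<in> borel_measurable lebesgue" and g_int: "integrable lebesgue (\<lambda>x. (norm (g j x))\<^sup>2)"
      using weak[of j] by (auto simp: has_weak_deriv_def square_integrable_def)
    have h_meas: "h j \<in> borel_measurable lebesgue"
      using g_meas continuous_imp_lebesgue_measurable[OF continuous_on_cube_cutoff[of \<rho>]]
      unfolding h_def by measurable
    have le: "(norm (h j x))\<^sup>2 \<le> (norm (g j x))\<^sup>2" for x
    proof (rule power_mono)
      have "norm (h j x) \<le> 1 * norm (g j x)"
        unfolding h_def norm_mult using cube_cutoff_props(1,2)[of \<rho> x] by (intro mult_right_mono) auto
      then show "norm (h j x) \<le> norm (g j x)" by simp
    qed simp
    have "integrable lebesgue (\<lambda>x. (norm (h j x))\<^sup>2)"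
    proof (rule Bochner_Integration.integrable_bound[OF g_int])
      show "(\<lambda>x. (norm (h j x))\<^sup>2) \<in> borel_measurable lebesgue" using h_meas by measurable
      show "AE x in lebesgue. norm ((norm (h j x))\<^sup>2) \<le> norm ((norm (g j x))\<^sup>2)"
        unfolding real_norm_def abs_power2 by (intro AE_I2 le)
    qed
    then show "square_integrable (h j)" "(\<integral>x. (norm (h j x))\<^sup>2 \<partial>lebesgue) \<le> (L2_norm (g j))\<^sup>2"
      unfolding L2 square_integrable_def using g_int h_meas le by (auto intro!: integral_mono)
  qed
  have high: "(norm (c k))\<^sup>2 \<le> (\<Sum>j\<in>UNIV. \<tau> * (norm (L2_inner (h j) (mode T k)))\<^sup>2)" if "k \<notin> low_modes N" for k
  proof -
    obtain j where "int N < \<bar>k j\<bar>"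
      using \<open>k \<notin> low_modes N\<close> by (auto simp: low_modes_def not_le)
    then have "real N + 1 \<le> \<bar>real_of_int (k j)\<bar>" by linarith
    then have "1 \<le> (\<bar>real_of_int (k j)\<bar> / (real N + 1)) ^ (2 * m)"
      by (intro one_le_power) simp
    also have "\<dots> = \<tau> * (frequency T k $ j) ^ (2 * m)"
      using \<open>0 < T\<close> by (simp add: \<tau>_def frequency_def power_divide power_even_abs)
    finally have "1 * (norm (c k))\<^sup>2 \<le> \<tau> * (frequency T k $ j) ^ (2 * m) * (norm (c k))\<^sup>2"
      by (rule mult_right_mono) simp
    also have "\<dots> = \<tau> * (norm (L2_inner (h j) (mode T k)))\<^sup>2"
      using coefficient_of_weak_deriv[OF \<open>\<rho> + 1 \<le> pi * T\<close> weak supp, of k j]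
      by (simp add: c_def h_def)
    also have "\<dots> \<le> (\<Sum>j\<in>UNIV. \<tau> * (norm (L2_inner (h j) (mode T k)))\<^sup>2)"
      by (rule member_le_sum) (auto simp: \<tau>_def zero_le_even_power)
    finally show ?thesis by simp
  qed
  have seminorm: "(\<Sum>j\<in>UNIV. (L2_norm (g j))\<^sup>2) = (sobolev_seminorm m v)\<^sup>2"
    by (simp add: sobolev_seminorm_def g_def sum_nonneg)
  have "(L2_norm v)\<^sup>2 \<le> ((\<Sum>k\<in>low_modes N. (norm (c k))\<^sup>2) / V + \<tau> * (sobolev_seminorm m v)\<^sup>2) + e"
    if "0 < e" for e
  proof -
    obtain K a where K: "finite K" and "(\<integral>x. (norm (v x - (\<Sum>k\<in>K. a k * mode T k x)))\<^sup>2 \<partial>lebesgue) < e"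
      using trig_approximation_L2[OF \<open>0 < T\<close> \<open>\<rho> + 1 \<le> pi * T\<close> v_sq supp \<open>0 < e\<close>] by blast
    then have "(L2_norm v)\<^sup>2 - (\<Sum>k\<in>K. (norm (c k))\<^sup>2) / V
        + V * (\<Sum>k\<in>K. (norm (a k - c k / V))\<^sup>2) < e"
      by (subst (asm) orthogonal_approximation_identity[OF K v_sq square_integrable_mode orth \<open>0 < V\<close>])
        (simp_all add: L2 c_def)
    moreover have "0 \<le> V * (\<Sum>k\<in>K. (norm (a k - c k / V))\<^sup>2)"
      using \<open>0 < V\<close> by (simp add: sum_nonneg)
    ultimately have "(L2_norm v)\<^sup>2 \<le> (\<Sum>k\<in>K. (norm (c k))\<^sup>2) / V + e" by linarith
    also have "(\<Sum>k\<in>K. (norm (c k))\<^sup>2) = (\<Sum>k\<in>K \<inter> low_modes N. (norm (c k))\<^sup>2) + (\<Sum>k\<in>K - low_modes N. (norm (c k))\<^sup>2)"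
      using K by (rule sum.Int_Diff)
    also have "(\<Sum>k\<in>K \<inter> low_modes N. (norm (c k))\<^sup>2) \<le> (\<Sum>k\<in>low_modes N. (norm (c k))\<^sup>2)"
      by (intro sum_mono2) (auto simp: low_modes_finite_card)
    also have "(\<Sum>k\<in>K - low_modes N. (norm (c k))\<^sup>2)
        \<le> (\<Sum>k\<in>K - low_modes N. \<Sum>j\<in>UNIV. \<tau> * (norm (L2_inner (h j) (mode T k)))\<^sup>2)"
      by (intro sum_mono high) auto
    also have "\<dots> = (\<Sum>j\<in>UNIV. \<tau> * (\<Sum>k\<in>K - low_modes N. (norm (L2_inner (h j) (mode T k)))\<^sup>2))"
      by (subst sum.swap) (simp add: sum_distrib_left)
    also have "\<dots> \<le> (\<Sum>j\<in>UNIV. \<tau> * (V * (L2_norm (g j))\<^sup>2))"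
    proof (intro sum_mono mult_left_mono)
      fix j :: 'd
      have "(\<Sum>k\<in>K - low_modes N. (norm (L2_inner (h j) (mode T k)))\<^sup>2) \<le> V * (\<integral>x. (norm (h j x))\<^sup>2 \<partial>lebesgue)"
        using K by (intro bessel_inequality h_sq square_integrable_mode orth \<open>0 < V\<close>) auto
      also have "\<dots> \<le> V * (L2_norm (g j))\<^sup>2" using h_le \<open>0 < V\<close> by (intro mult_left_mono) auto
      finally show "(\<Sum>k\<in>K - low_modes N. (norm (L2_inner (h j) (mode T k)))\<^sup>2) \<le> V * (L2_norm (g j))\<^sup>2" .
    qed (simp add: \<tau>_def zero_le_even_power)
    also have "\<dots> = V * (\<tau> * (sobolev_seminorm m v)\<^sup>2)"
      by (simp add: seminorm[symmetric] sum_distrib_left mult_ac)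
    finally show ?thesis using \<open>0 < V\<close> by (simp add: divide_right_mono add_divide_distrib)
  qed
  then have "(L2_norm v)\<^sup>2 \<le> (\<Sum>k\<in>low_modes N. (norm (c k))\<^sup>2) / V + \<tau> * (sobolev_seminorm m v)\<^sup>2"
    by (rule field_le_epsilon)
  moreover have "c k = wave_integral v (- frequency T k)" for k
    unfolding c_def
  proof (rule L2_inner_mode)
    show "v \<in> borel_measurable lebesgue" using v_sq by (simp add: square_integrable_def)
    show "AE x in lebesgue. x \<notin> period_cube T \<longrightarrow> v x = 0"
      using supp
    proof eventually_elim
      case (elim x)
      have "\<rho> \<le> pi * T" using \<open>\<rho> + 1 \<le> pi * T\<close> by simp
      with elim show ?case unfolding period_cube_def mem_Collect_eq by (meson less_imp_le less_le_trans)
    qed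
  qed
  ultimately show ?thesis by (simp add: V_def \<tau>_def)
qed

section \<open>Trading smallness on the open set against frequency\<close>

text \<open>The inequality is that of Cauchy and Schwarz on the cube. It is Bessel's inequality for \<open>|v|\<close> and
the constant mode alone.\<close>

lemma supported_L1_L2:
  fixes v :: "real^'d \<Rightarrow> complex"
  assumes "0 < T" and v: "square_integrable v"
    and supp: "AE x in lebesgue. x \<notin> period_cube T \<longrightarrow> v x = 0"
  shows "integrable lebesgue v"
    and "(\<integral>x. norm (v x) \<partial>lebesgue)\<^sup>2 \<le> (2 * pi * T) ^ CARD('d) * (L2_norm v)\<^sup>2"
proof -
  define e where "e = (mode T (\<lambda>_. 0) :: real^'d \<Rightarrow> complex)"
  have e: "e x = of_real (indicator (period_cube T) x)" for x
    by (simp add: e_def mode_def frequency_def inner_vec_def)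
  have e_sq: "square_integrable e" unfolding e_def by (rule square_integrable_mode)
  have v_meas: "v \<in> borel_measurable lebesgue" using v by (simp add: square_integrable_def)
  have "integrable lebesgue (\<lambda>x. v x * cnj (e x))"
    by (rule square_integrable_integrable_mult[OF v e_sq])
  moreover have "AE x in lebesgue. v x * cnj (e x) = v x"
    using supp by eventually_elim (auto simp: e)
  ultimately show "integrable lebesgue v"
    using integrable_cong_AE[OF borel_measurable_integrable v_meas] by blast
  define f where "f x = complex_of_real (norm (v x))" for x
  have f_sq: "square_integrable f"
    using v unfolding square_integrable_def f_def by auto
  have "AE x in lebesgue. f x * cnj (e x) = f x"
    using supp by eventually_elim (auto simp: e f_def)
  then have "L2_inner f e = (\<integral>x. f x \<partial>lebesgue)"
    unfolding L2_inner_def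
  proof (rule integral_cong_AE[rotated 2])
    show "f \<in> borel_measurable lebesgue" using f_sq by (simp only: square_integrable_def)
  qed (rule borel_measurable_integrable[OF square_integrable_integrable_mult[OF f_sq e_sq]])
  also have "\<dots> = of_real (\<integral>x. norm (v x) \<partial>lebesgue)"
    unfolding f_def using \<open>integrable lebesgue v\<close> by (intro integral_of_real integrable_norm)
  finally have "(norm (L2_inner f e))\<^sup>2 = (\<integral>x. norm (v x) \<partial>lebesgue)\<^sup>2"
    by simp
  moreover have "(\<Sum>k\<in>{\<lambda>_::'d. 0}. (norm (L2_inner f (mode T k)))\<^sup>2)
      \<le> (2 * pi * T) ^ CARD('d) * (\<integral>x. (norm (f x))\<^sup>2 \<partial>lebesgue)"
    using \<open>0 < T\<close> by (intro bessel_inequality f_sq square_integrable_mode mode_orthogonal) auto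
  ultimately show "(\<integral>x. norm (v x) \<partial>lebesgue)\<^sup>2 \<le> (2 * pi * T) ^ CARD('d) * (L2_norm v)\<^sup>2"
    by (simp add: e_def f_def L2_norm_def)
qed

text \<open>The low modes have frequencies of size \<open>O(N + 1)\<close>, and at each of them the propagation of smallness is applied
with \<open>n = D (N + 1)\<close> and \<open>s = D' (N + 1)\<^sup>2\<close>. If \<open>D\<close> is large enough, the error
terms, which are proportional to \<open>\<parallel>v\<parallel>\<close>, decay exponentially in \<open>N\<close>, whereas the number of low modes grows only
polynomially. Their total is then at most half of \<open>\<parallel>v\<parallel>\<^sup>2\<close> and is absorbed on the left. The case
\<open>N = 0\<close> is a form of the Poincare inequality.\<close>

lemma L2_norm_smallness_frequency_trade_off:
  fixes A B :: "(real^'d) set"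
  assumes "compact A" "open B" "B \<noteq> {}"
  obtains T C :: real and D D' :: nat where "0 < T" "0 < C" "0 < D'"
    "\<And>v m N \<epsilon>. v \<in> sobolev m \<Longrightarrow> (AE x in lebesgue. x \<notin> A \<longrightarrow> v x = 0) \<Longrightarrow>
      (\<And>\<xi>. \<xi> \<in> B \<Longrightarrow> norm (wave_integral v \<xi>) \<le> \<epsilon>) \<Longrightarrow>
      (L2_norm v)\<^sup>2 \<le> C * (2 * real N + 1) ^ CARD('d)
          * (1 + 2 * real D' * (real N + 1)\<^sup>2) ^ (2 * (D * (N + 1))) * \<epsilon>\<^sup>2
        + 2 * (T / (real N + 1)) ^ (2 * m) * (sobolev_seminorm m v)\<^sup>2"
proof -
  obtain R where "0 < R" and R: "\<And>x. x \<in> A \<Longrightarrow> norm x < R"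
    using compact_imp_bounded[OF \<open>compact A\<close>] bounded_pos_less by blast
  \<comment> \<open>Half the side of the cube is \<open>\<pi> T\<close>, which leaves room for the cutoff to drop to zero between \<open>R\<close> and \<open>R + 1\<close>.\<close>
  define T where "T = R + 1"
  have "0 < T" using \<open>0 < R\<close> by (simp add: T_def)
  have RT: "R + 1 \<le> pi * T"
    using mult_right_mono[of 1 pi T] pi_ge_two \<open>0 < T\<close> by (simp add: T_def)
  obtain b where "b \<in> B" using \<open>B \<noteq> {}\<close> by blast
  then obtain \<delta> where "0 < \<delta>" and \<delta>: "cball b \<delta> \<subseteq> B"
    using \<open>open B\<close> open_contains_cball by blast
  define d where "d = CARD('d)"
  define V where "V = (2 * pi * T) ^ d"
  have "0 < V" using \<open>0 < T\<close> by (simp add: V_def)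
  define r where "r = norm b + real d / T"
  have "0 \<le> r" using \<open>0 < T\<close> by (simp add: r_def)
  \<comment> \<open>The first term beats the growth of the exponential series at radius \<open>r (N + 1)\<close>; the others leave a decay that beats the number of low modes.\<close>
  define D where "D = nat \<lceil>exp 1 * (R * r) + real d + 1\<rceil>"
  have D: "exp 1 * (R * r) + real d + 1 \<le> real D" unfolding D_def by (rule real_nat_ceiling_ge)
  \<comment> \<open>Large enough for \<open>n\<close> of the \<open>s\<close> steps to stay within distance \<open>\<delta>\<close> of \<open>b\<close>; the successor makes \<open>s\<close> positive.\<close>
  define D' where "D' = Suc (nat \<lceil>real D * r / \<delta>\<rceil>)"
  have "real D * r / \<delta> \<le> real D'" unfolding D'_def using real_nat_ceiling_ge[of "real D * r / \<delta>"] by linarith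
  then have D': "real D * r \<le> real D' * \<delta>" using \<open>0 < \<delta>\<close> by (simp add: divide_le_eq)
  show thesis
  proof (rule that[of T "4 / V" D' D])
    show "0 < T" "0 < 4 / V" "0 < D'" using \<open>0 < T\<close> \<open>0 < V\<close> by (simp_all add: D'_def)
    fix v :: "real^'d \<Rightarrow> complex" and m N :: nat and \<epsilon> :: real
    assume v: "v \<in> sobolev m" and vA: "AE x in lebesgue. x \<notin> A \<longrightarrow> v x = 0"
      and small: "\<And>\<xi>. \<xi> \<in> B \<Longrightarrow> norm (wave_integral v \<xi>) \<le> \<epsilon>"
    have "0 \<le> \<epsilon>" using small[OF \<open>b \<in> B\<close>] norm_ge_zero order_trans by blast
    have v_sq: "square_integrable v" using v by (simp add: sobolev_def)
    have supp_ball: "AE x in lebesgue. v x \<noteq> 0 \<longrightarrow> norm x \<le> R"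
      using vA by eventually_elim (use R in \<open>auto intro: less_imp_le\<close>)
    have supp_cube: "AE x in lebesgue. v x \<noteq> 0 \<longrightarrow> (\<forall>i. \<bar>x $ i\<bar> < R)"
      using vA
    proof eventually_elim
      case (elim x)
      then show ?case using R[of x] component_le_norm_cart[of x] by (auto intro: le_less_trans)
    qed
    have "AE x in lebesgue. x \<notin> period_cube T \<longrightarrow> v x = 0"
      using supp_cube
    proof eventually_elim
      case (elim x)
      have "R \<le> pi * T" using RT by simp
      with elim show ?case unfolding period_cube_def mem_Collect_eq by (meson less_imp_le less_le_trans)
    qed
    note L1 = supported_L1_L2[OF \<open>0 < T\<close> v_sq this, folded d_def, folded V_def]
    define J where "J = (\<integral>x. norm (v x) \<partial>lebesgue)"
    have "0 \<le> J" by (simp add: J_def)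
    define n where "n = D * (N + 1)"
    define s where "s = D' * (N + 1)\<^sup>2"
    have "0 < s" by (simp add: s_def D'_def)
    define \<tau> where "\<tau> = exp (- (real d + 1) * (real N + 1))"
    have each: "(norm (wave_integral v (- frequency T k)))\<^sup>2
        \<le> 2 * ((1 + 2 * real s) ^ (2 * n) * \<epsilon>\<^sup>2) + 2 * (\<tau>\<^sup>2 * (V * (L2_norm v)\<^sup>2))"
      if k: "k \<in> low_modes N" for k
    proof -
      define y where "y = - frequency T k - b"
      have "norm (frequency T k) \<le> (\<Sum>i\<in>UNIV. \<bar>frequency T k $ i\<bar>)" by (rule norm_le_l1_cart)
      also have "\<dots> \<le> (\<Sum>i\<in>(UNIV :: 'd set). real N / T)"
      proof (rule sum_mono)
        fix i
        have "\<bar>k i\<bar> \<le> int N" using k by (simp add: low_modes_def)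
        then have "\<bar>real_of_int (k i)\<bar> \<le> real N" by linarith
        then show "\<bar>frequency T k $ i\<bar> \<le> real N / T"
          using \<open>0 < T\<close> by (simp add: frequency_def divide_right_mono)
      qed
      also have "\<dots> = real d / T * real N" by (simp add: d_def)
      finally have "norm y \<le> norm b + real d / T * real N"
        unfolding y_def using norm_triangle_ineq4[of "- frequency T k" b] by simp
      also have "\<dots> \<le> norm b * (real N + 1) + real d / T * (real N + 1)"
        using \<open>0 < T\<close> by (intro add_mono mult_left_mono) (auto simp: algebra_simps)
      also have "\<dots> = r * (real N + 1)" by (simp add: r_def algebra_simps)
      finally have y: "norm y \<le> r * (real N + 1)" .
      have "real n * norm y \<le> real n * (r * (real N + 1))" using y by (intro mult_left_mono) auto
      also have "\<dots> = (real D * r) * (real N + 1)\<^sup>2" by (simp add: n_def power2_eq_square algebra_simps)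
      also have "\<dots> \<le> (real D' * \<delta>) * (real N + 1)\<^sup>2" using D' by (intro mult_right_mono) auto
      also have "\<dots> = real s * \<delta>" by (simp add: s_def)
      finally have ns: "real n * norm y \<le> real s * \<delta>" .
      have "norm (wave_integral v (b + y)) \<le>
          (1 + 2 * real s) ^ n * \<epsilon> + exp (exp 1 * (R * norm y) - real n) * J"
        unfolding J_def
      proof (rule wave_integral_continuation[OF L1(1) supp_ball _ \<open>0 < s\<close> ns _ \<open>0 \<le> \<epsilon>\<close>])
        show "norm (wave_integral v (b + z)) \<le> \<epsilon>" if "norm z \<le> \<delta>" for z
          using that \<delta> by (intro small) (auto simp: dist_norm)
      qed (use \<open>0 < R\<close> in simp)
      also have "exp (exp 1 * (R * norm y) - real n) * J \<le> \<tau> * J"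
      proof (rule mult_right_mono)
        have "exp 1 * (R * norm y) \<le> exp 1 * (R * (r * (real N + 1)))"
          using y \<open>0 < R\<close> by (intro mult_left_mono) auto
        moreover have "(exp 1 * (R * r) + real d + 1) * (real N + 1) \<le> real D * (real N + 1)"
          using D by (intro mult_right_mono) auto
        ultimately have "exp 1 * (R * norm y) - real n \<le> - (real d + 1) * (real N + 1)"
          by (simp add: n_def algebra_simps)
        then show "exp (exp 1 * (R * norm y) - real n) \<le> \<tau>" by (simp add: \<tau>_def)
      qed fact
      finally have "norm (wave_integral v (- frequency T k)) \<le> (1 + 2 * real s) ^ n * \<epsilon> + \<tau> * J"
        by (simp add: y_def)
      then have "(norm (wave_integral v (- frequency T k)))\<^sup>2 \<le> ((1 + 2 * real s) ^ n * \<epsilon> + \<tau> * J)\<^sup>2"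
        by (rule power_mono) simp
      also have "\<dots> \<le> 2 * ((1 + 2 * real s) ^ n * \<epsilon>)\<^sup>2 + 2 * (\<tau> * J)\<^sup>2"
        using sum_squares_bound[of "(1 + 2 * real s) ^ n * \<epsilon>" "\<tau> * J"] by (simp add: power2_sum)
      also have "\<dots> = 2 * ((1 + 2 * real s) ^ (2 * n) * \<epsilon>\<^sup>2) + 2 * (\<tau>\<^sup>2 * J\<^sup>2)"
        by (simp add: power_mult_distrib power_mult[symmetric] mult.commute[of n 2])
      also have "\<tau>\<^sup>2 * J\<^sup>2 \<le> \<tau>\<^sup>2 * (V * (L2_norm v)\<^sup>2)"
        using L1(2) by (intro mult_left_mono) (auto simp: J_def)
      finally show ?thesis by simp
    qed
    define M where "M = (2 * real N + 1) ^ d"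
    have "0 \<le> M" by (simp add: M_def)
    have absorb: "M * \<tau>\<^sup>2 \<le> 1 / 4"
    proof -
      have "M \<le> exp (2 * real N) ^ d"
        unfolding M_def using exp_ge_add_one_self[of "2 * real N"]
        by (intro power_mono) linarith+
      also have "\<dots> = exp (2 * real d * real N)" by (simp add: exp_of_nat_mult[symmetric] mult_ac)
      finally have "M * \<tau>\<^sup>2 \<le> exp (2 * real d * real N) * \<tau>\<^sup>2" by (rule mult_right_mono) simp
      also have "\<dots> = exp (2 * real d * real N - 2 * ((real d + 1) * (real N + 1)))"
        by (simp add: \<tau>_def exp_double[symmetric] exp_add[symmetric] algebra_simps)
      also have "\<dots> \<le> exp (- 2)" by (simp add: algebra_simps)
      also have "\<dots> \<le> 1 / 4"
      proof -
        have "(2::real)\<^sup>2 \<le> (exp 1)\<^sup>2" using exp_ge_add_one_self[of 1] by (intro power_mono) auto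
        then show ?thesis by (simp add: exp_minus exp_double[symmetric] field_simps)
      qed
      finally show ?thesis .
    qed
    have "(\<Sum>k\<in>low_modes N. (norm (wave_integral v (- frequency T k)))\<^sup>2)
      \<le> (\<Sum>k\<in>(low_modes N :: ('d \<Rightarrow> int) set). 2 * ((1 + 2 * real s) ^ (2 * n) * \<epsilon>\<^sup>2) + 2 * (\<tau>\<^sup>2 * (V * (L2_norm v)\<^sup>2)))"
      by (intro sum_mono each)
    also have "\<dots> = M * (2 * ((1 + 2 * real s) ^ (2 * n) * \<epsilon>\<^sup>2) + 2 * (\<tau>\<^sup>2 * (V * (L2_norm v)\<^sup>2)))"
      by (simp add: low_modes_finite_card M_def d_def add.commute)
    also have "\<dots> / V = 2 / V * M * (1 + 2 * real s) ^ (2 * n) * \<epsilon>\<^sup>2 + 2 * (M * \<tau>\<^sup>2) * (L2_norm v)\<^sup>2"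
      using \<open>0 < V\<close> by (simp add: field_simps)
    finally have "(\<Sum>k\<in>low_modes N. (norm (wave_integral v (- frequency T k)))\<^sup>2) / V
      \<le> 2 / V * M * (1 + 2 * real s) ^ (2 * n) * \<epsilon>\<^sup>2 + 2 * (M * \<tau>\<^sup>2) * (L2_norm v)\<^sup>2"
      using \<open>0 < V\<close> by (simp add: divide_right_mono)
    moreover have "2 * (M * \<tau>\<^sup>2) * (L2_norm v)\<^sup>2 \<le> 1 / 2 * (L2_norm v)\<^sup>2"
      using absorb by (intro mult_right_mono) auto
    moreover note low_frequency_estimate[OF \<open>0 < T\<close> RT v supp_cube, of N, folded d_def, folded V_def]
    ultimately have "(L2_norm v)\<^sup>2 \<le> 2 * (2 / V * M * (1 + 2 * real s) ^ (2 * n) * \<epsilon>\<^sup>2)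
        + 2 * ((T / (real N + 1)) ^ (2 * m) * (sobolev_seminorm m v)\<^sup>2)"
      by linarith
    then show "(L2_norm v)\<^sup>2 \<le> 4 / V * (2 * real N + 1) ^ CARD('d)
          * (1 + 2 * real D' * (real N + 1)\<^sup>2) ^ (2 * (D * (N + 1))) * \<epsilon>\<^sup>2
        + 2 * (T / (real N + 1)) ^ (2 * m) * (sobolev_seminorm m v)\<^sup>2"
      by (simp add: M_def d_def s_def n_def add.commute mult.assoc)
  qed
qed

section \<open>The logarithmic stability estimate\<close>

text \<open>For \<open>x = L\<^sup>\<kappa>\<close> with \<open>\<kappa> < 1\<close> the exponents \<open>x\<close> and \<open>x ln x\<close> are of lower
order than \<open>L\<close>, so the factor \<open>exp (-2 L)\<close> wins for large \<open>L\<close>. For bounded \<open>L\<close>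
everything is bounded because all the other factors increase. This is the place where \<open>\<mu> < m\<close> enters
the main result.\<close>

lemma frequency_growth_absorbed:
  fixes C D c d \<kappa> \<mu> :: real
  assumes "0 < C" "0 < c" "0 \<le> D" "0 \<le> d" "0 \<le> \<kappa>" "\<kappa> < 1" "0 \<le> \<mu>"
  defines "W \<equiv> \<lambda>x. C * (exp (d * x) * exp (D * ((x + 1) * ln (1 + c * (x + 1)\<^sup>2))))"
  obtains M where "0 < M" 
    "\<And>L x. 0 < L \<Longrightarrow> 0 \<le> x \<Longrightarrow> x \<le> L powr \<kappa> \<Longrightarrow> W x * exp (- 2 * L) * L powr \<mu> \<le> M"
proof -
  \<comment> \<open>An exponent strictly between 0 and 1 also when \<open>\<kappa> = 0\<close>, so that \<open>L\<^sup>\<theta>\<close> tends to infinity.\<close>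
  define \<theta> where "\<theta> = (1 + \<kappa>) / 2"
  have \<theta>: "0 < \<theta>" "\<kappa> \<le> \<theta>" "\<theta> < 1" using assms by (simp_all add: \<theta>_def)
  have W_mono: "W x \<le> W y" if "0 \<le> x" "x \<le> y" for x y
  proof -
    have "c * (x + 1)\<^sup>2 \<le> c * (y + 1)\<^sup>2"
      using that \<open>0 < c\<close> by (intro mult_left_mono power_mono) auto
    moreover have "0 \<le> c * (x + 1)\<^sup>2" using \<open>0 < c\<close> by simp
    ultimately have ln: "0 \<le> ln (1 + c * (x + 1)\<^sup>2)" "ln (1 + c * (x + 1)\<^sup>2) \<le> ln (1 + c * (y + 1)\<^sup>2)"
      by (auto intro!: ln_mono)
    then have "(x + 1) * ln (1 + c * (x + 1)\<^sup>2) \<le> (y + 1) * ln (1 + c * (y + 1)\<^sup>2)"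
      using that by (intro mult_mono) auto
    then show ?thesis
      unfolding W_def using that ln \<open>0 < C\<close> \<open>0 \<le> D\<close> \<open>0 \<le> d\<close>
      by (intro mult_left_mono mult_mono iffD2[OF exp_le_cancel_iff]) auto
  qed
  have W_pos: "0 < W x" for x using \<open>0 < C\<close> by (simp add: W_def)
  have "filterlim (\<lambda>L. d * L powr \<theta> + D * ((L powr \<theta> + 1) * ln (1 + c * (L powr \<theta> + 1)\<^sup>2)) + \<mu> * ln L - L) at_bot at_top"
    using \<theta> \<open>0 < c\<close> by real_asymp
  then have "\<forall>\<^sub>F L in at_top. d * L powr \<theta> + D * ((L powr \<theta> + 1) * ln (1 + c * (L powr \<theta> + 1)\<^sup>2)) + \<mu> * ln L - L \<le> 0"
    unfolding filterlim_at_bot by blast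
  then obtain L0 where L0: "\<And>L. L0 \<le> L \<Longrightarrow>
      d * L powr \<theta> + D * ((L powr \<theta> + 1) * ln (1 + c * (L powr \<theta> + 1)\<^sup>2)) + \<mu> * ln L - L \<le> 0"
    by (auto simp: eventually_at_top_linorder)
  define L1 where "L1 = max 1 L0"
  have large: "W (L powr \<kappa>) * exp (- 2 * L) * L powr \<mu> \<le> C" if "L1 \<le> L" for L
  proof -
    have "1 \<le> L" "L0 \<le> L" using that by (auto simp: L1_def)
    have "W (L powr \<kappa>) \<le> W (L powr \<theta>)"
      using \<open>1 \<le> L\<close> \<theta> by (intro W_mono powr_mono) auto
    then have "W (L powr \<kappa>) * exp (- 2 * L) * L powr \<mu> \<le> W (L powr \<theta>) * exp (- 2 * L) * L powr \<mu>"
      by (intro mult_right_mono) auto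
    also have "\<dots> = C * exp (d * L powr \<theta> + D * ((L powr \<theta> + 1) * ln (1 + c * (L powr \<theta> + 1)\<^sup>2)) - 2 * L + \<mu> * ln L)"
      using \<open>1 \<le> L\<close> by (simp add: W_def powr_def exp_add exp_diff exp_minus field_simps)
    also have "\<dots> \<le> C * 1"
      using L0[OF \<open>L0 \<le> L\<close>] \<open>1 \<le> L\<close> \<open>0 < C\<close> by (intro mult_left_mono) auto
    finally show ?thesis by simp
  qed
  have small: "W (L powr \<kappa>) * exp (- 2 * L) * L powr \<mu> \<le> W (L1 powr \<kappa>) * L1 powr \<mu>" if "0 < L" "L \<le> L1" for L
  proof -
    have "W (L powr \<kappa>) * exp (- 2 * L) * L powr \<mu> \<le> W (L1 powr \<kappa>) * 1 * L1 powr \<mu>"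
      using that assms by (intro mult_mono W_mono powr_mono2 less_imp_le[OF W_pos]) (auto simp: less_imp_le[OF W_pos])
    then show ?thesis by simp
  qed
  show thesis
  proof (rule that[of "C + W (L1 powr \<kappa>) * L1 powr \<mu>"])
    have "0 \<le> W (L1 powr \<kappa>) * L1 powr \<mu>" using W_pos[of "L1 powr \<kappa>"] by simp
    then show "0 < C + W (L1 powr \<kappa>) * L1 powr \<mu>" using \<open>0 < C\<close> by linarith
    show "W x * exp (- 2 * L) * L powr \<mu> \<le> C + W (L1 powr \<kappa>) * L1 powr \<mu>"
      if "0 < L" "0 \<le> x" "x \<le> L powr \<kappa>" for L x
    proof -
      have "W x * exp (- 2 * L) * L powr \<mu> \<le> W (L powr \<kappa>) * exp (- 2 * L) * L powr \<mu>"
        using that by (intro mult_right_mono W_mono) auto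
      also have "\<dots> \<le> C + W (L1 powr \<kappa>) * L1 powr \<mu>"
        using large[of L] small[OF \<open>0 < L\<close>] \<open>0 < C\<close> \<open>0 \<le> W (L1 powr \<kappa>) * L1 powr \<mu>\<close> by linarith
      finally show ?thesis .
    qed
  qed
qed

lemma wave_integral_lipschitz:
  fixes v :: "real^'d \<Rightarrow> complex"
  assumes v: "integrable lebesgue v"
    and supp: "AE x in lebesgue. v x \<noteq> 0 \<longrightarrow> norm x \<le> R"
  shows "norm (wave_integral v \<xi> - wave_integral v \<eta>) \<le> R * (\<integral>x. norm (v x) \<partial>lebesgue) * norm (\<xi> - \<eta>)"
proof -
  have "wave_integral v \<xi> - wave_integral v \<eta> = (\<integral>x. wave \<xi> x * v x - wave \<eta> x * v x \<partial>lebesgue)"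
    unfolding wave_integral_def by (simp add: integrable_wave_times[OF v])
  also have "norm \<dots> \<le> (\<integral>x. norm (wave \<xi> x * v x - wave \<eta> x * v x) \<partial>lebesgue)"
    by (rule integral_norm_bound)
  also have "\<dots> \<le> (\<integral>x. (R * norm (\<xi> - \<eta>)) * norm (v x) \<partial>lebesgue)"
  proof (rule integral_mono_AE)
    show "integrable lebesgue (\<lambda>x. norm (wave \<xi> x * v x - wave \<eta> x * v x))"
      by (intro integrable_norm Bochner_Integration.integrable_diff integrable_wave_times v)
    show "integrable lebesgue (\<lambda>x. (R * norm (\<xi> - \<eta>)) * norm (v x))"
      using v by (intro integrable_mult_right integrable_norm)
    show "AE x in lebesgue. norm (wave \<xi> x * v x - wave \<eta> x * v x) \<le> R * norm (\<xi> - \<eta>) * norm (v x)"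
      using supp
    proof eventually_elim
      case (elim x)
      have "norm (wave \<xi> x - wave \<eta> x) \<le> R * norm (\<xi> - \<eta>)" if "v x \<noteq> 0"
      proof -
        have "wave \<xi> x - wave \<eta> x = wave \<eta> x * (wave (\<xi> - \<eta>) x - 1)"
          by (simp add: inner_diff_left algebra_simps exp_diff)
        then have "norm (wave \<xi> x - wave \<eta> x) = norm (wave (\<xi> - \<eta>) x - 1)" by (simp add: norm_mult)
        also have "\<dots> \<le> \<bar>(\<xi> - \<eta>) \<bullet> x\<bar>" by (rule norm_exp_i_minus_1_le)
        also have "\<dots> \<le> norm (\<xi> - \<eta>) * norm x" by (rule Cauchy_Schwarz_ineq2)
        also have "\<dots> \<le> norm (\<xi> - \<eta>) * R" using elim that by (intro mult_left_mono) auto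
        finally show ?thesis by (simp add: mult.commute)
      qed
      then show ?case
        by (cases "v x = 0") (simp_all add: left_diff_distrib[symmetric] norm_mult mult_right_mono)
    qed
  qed
  also have "\<dots> = R * (\<integral>x. norm (v x) \<partial>lebesgue) * norm (\<xi> - \<eta>)" by simp
  finally show ?thesis .
qed

lemma continuous_wave_integral:
  fixes v :: "real^'d \<Rightarrow> complex"
  assumes "square_integrable v" "compact A" and vA: "AE x in lebesgue. x \<notin> A \<longrightarrow> v x = 0"
  shows "continuous_on UNIV (wave_integral v)"
proof -
  obtain R where "0 < R" and R: "\<And>x. x \<in> A \<Longrightarrow> norm x \<le> R"
    using compact_imp_bounded[OF \<open>compact A\<close>] bounded_pos by blast
  have supp: "AE x in lebesgue. v x \<noteq> 0 \<longrightarrow> norm x \<le> R"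
    using vA by eventually_elim (use R in auto)
  have "R \<le> pi * R" using mult_right_mono[of 1 pi R] pi_ge_two \<open>0 < R\<close> by simp
  have "AE x in lebesgue. x \<notin> period_cube R \<longrightarrow> v x = 0"
    using supp
  proof eventually_elim
    case (elim x)
    then show ?case
      using component_le_norm_cart[of x] \<open>R \<le> pi * R\<close> unfolding period_cube_def mem_Collect_eq
      by (meson order_trans)
  qed
  from supported_L1_L2(1)[OF \<open>0 < R\<close> assms(1) this] have v: "integrable lebesgue v" .
  define K where "K = R * (\<integral>x. norm (v x) \<partial>lebesgue)"
  have "K-lipschitz_on UNIV (wave_integral v)"
    using wave_integral_lipschitz[OF v supp] \<open>0 < R\<close>
    by (intro lipschitz_onI) (auto simp: K_def dist_norm)
  then show ?thesis by (rule lipschitz_on_continuous_on)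
qed

text \<open>A continuous function that exceeds its essential supremum at a point of an open set does so on a nonempty open subset,
which is not a null set.\<close>

lemma continuous_norm_le_Linfty_norm:
  fixes F :: "real^'d \<Rightarrow> complex"
  assumes "open B" and F: "continuous_on UNIV F" and fin: "Linfty_norm B F < top" and "\<xi> \<in> B"
  shows "norm (F \<xi>) \<le> enn2real (Linfty_norm B F)"
proof (rule ccontr)
  define E where "E = enn2real (Linfty_norm B F)"
  assume "\<not> norm (F \<xi>) \<le> enn2real (Linfty_norm B F)"
  then have gt: "E < norm (F \<xi>)" by (simp add: E_def)
  have "Linfty_norm B F = ennreal E" unfolding E_def using fin by simp
  then have "AE x in lebesgue_on B. ennreal (norm (F x)) \<le> ennreal E"
    using esssup_AE[of "\<lambda>\<xi>. ennreal (norm (F \<xi>))" "lebesgue_on B"] by (simp add: Linfty_norm_def)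
  then have "AE x in lebesgue. x \<in> B \<longrightarrow> norm (F x) \<le> E"
    using \<open>open B\<close> by (simp add: AE_restrict_space_iff ennreal_le_iff E_def)
  then have "AE x in lebesgue. x \<notin> {x \<in> B. E < norm (F x)}"
    by eventually_elim auto
  moreover have "open {x \<in> B. E < norm (F x)}"
  proof -
    have "open ((\<lambda>x. norm (F x)) -` {E<..})"
      using F by (intro open_vimage continuous_intros) auto
    then have "open (B \<inter> (\<lambda>x. norm (F x)) -` {E<..})" using \<open>open B\<close> by (intro open_Int)
    then show ?thesis by (simp add: vimage_def Int_def)
  qed
  moreover from this have "{x \<in> B. E < norm (F x)} \<in> sets lebesgue" by auto
  ultimately have "negligible {x \<in> B. E < norm (F x)}"
    using AE_iff_null[of lebesgue "\<lambda>x. x \<notin> {x \<in> B. E < norm (F x)}"]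
    by (simp add: negligible_iff_null_sets)
  moreover have "{x \<in> B. E < norm (F x)} \<noteq> {}" using gt \<open>\<xi> \<in> B\<close> by blast
  ultimately show False
    using open_not_negligible \<open>open {x \<in> B. E < norm (F x)}\<close> by blast
qed


theorem corollary3p3:
  fixes A B :: "(real^'d) set" and m :: nat and \<gamma> \<mu> :: real
  assumes "compact A" and "open B" and "B \<noteq> {}"
    and "0 < m" and "0 < \<gamma>" and "0 \<le> \<mu>" and "\<mu> < real m"
  shows "\<exists>c>0. \<forall>v :: real^'d \<Rightarrow> complex.
           v \<in> sobolev m \<longrightarrow>
           (AE x in lebesgue. x \<notin> A \<longrightarrow> v x = 0) \<longrightarrow>
           sobolev_seminorm m v \<le> \<gamma> \<longrightarrow>
           Linfty_norm B (fourier v) < 1 \<longrightarrow>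
           (if Linfty_norm B (fourier v) = 0
            then (AE x in lebesgue. v x = 0)
            else L2_norm v \<le> c * ln (1 / enn2real (Linfty_norm B (fourier v))) powr (- \<mu>))"
proof (rule L2_norm_smallness_frequency_trade_off[OF assms(1-3)])
  define d where "d = CARD('d)"
  define P where "P = (2 * pi) ^ d"
  have "0 < P" by (simp add: P_def)
  fix T C :: real and D D' :: nat
  assume "0 < T" "0 < C" "0 < D'" and gap:
    "\<And>v m N \<epsilon>. v \<in> sobolev m \<Longrightarrow> (AE x in lebesgue. x \<notin> A \<longrightarrow> v x = 0) \<Longrightarrow>
      (\<And>\<xi>. \<xi> \<in> B \<Longrightarrow> norm (wave_integral v \<xi>) \<le> \<epsilon>) \<Longrightarrow>
      (L2_norm v)\<^sup>2 \<le> C * (2 * real N + 1) ^ CARD('d)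
          * (1 + 2 * real D' * (real N + 1)\<^sup>2) ^ (2 * (D * (N + 1))) * \<epsilon>\<^sup>2
        + 2 * (T / (real N + 1)) ^ (2 * m) * (sobolev_seminorm m v)\<^sup>2"
  note gap = gap[folded d_def]
  define W where "W x = C * P\<^sup>2 * (exp (2 * real d * x)
      * exp (2 * real D * ((x + 1) * ln (1 + 2 * real D' * (x + 1)\<^sup>2))))" for x
  define \<kappa> where "\<kappa> = \<mu> / real m"
  have \<kappa>: "0 \<le> \<kappa>" "\<kappa> < 1" "\<kappa> * real m = \<mu>" using assms(4-7) by (simp_all add: \<kappa>_def)
  obtain M where "0 < M" and M:
    "\<And>L x. 0 < L \<Longrightarrow> 0 \<le> x \<Longrightarrow> x \<le> L powr \<kappa> \<Longrightarrow> W x * exp (- 2 * L) * L powr (2 * \<mu>) \<le> M"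
    unfolding W_def
    by (rule frequency_growth_absorbed[of "C * P\<^sup>2" "2 * real D'" "2 * real D" "2 * real d" \<kappa> "2 * \<mu>"])
      (use \<open>0 < C\<close> \<open>0 < P\<close> \<open>0 < D'\<close> \<kappa> assms(6) in auto)
  define c where "c = sqrt (M + 2 * T ^ (2 * m) * \<gamma>\<^sup>2)"
  have "0 < M + 2 * T ^ (2 * m) * \<gamma>\<^sup>2" using \<open>0 < M\<close> by (simp add: add_pos_nonneg zero_le_even_power)
  then have "0 < c" and c2: "c\<^sup>2 = M + 2 * T ^ (2 * m) * \<gamma>\<^sup>2" by (simp_all add: c_def)
  have claim: "if Linfty_norm B (fourier v) = 0 then (AE x in lebesgue. v x = 0)
      else L2_norm v \<le> c * ln (1 / enn2real (Linfty_norm B (fourier v))) powr (- \<mu>)"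
    if v: "v \<in> sobolev m" and vA: "AE x in lebesgue. x \<notin> A \<longrightarrow> v x = 0"
      and semi: "sobolev_seminorm m v \<le> \<gamma>" and lt1: "Linfty_norm B (fourier v) < 1" for v :: "real^'d \<Rightarrow> complex"
  proof -
    define E where "E = enn2real (Linfty_norm B (fourier v))"
    have fin: "Linfty_norm B (fourier v) < top" using lt1 by (simp add: order_less_trans[OF _ ennreal_one_less_top])
    then have E: "Linfty_norm B (fourier v) = ennreal E" and "0 \<le> E" by (simp_all add: E_def)
    then have "E < 1" using lt1 by (simp add: ennreal_less_one_iff)
    have v_sq: "square_integrable v" using v by (simp add: sobolev_def)
    have fourier: "fourier v \<xi> = wave_integral v \<xi> / of_real P" for \<xi>
      by (simp add: fourier_def wave_integral_def P_def d_def)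
    have small: "norm (wave_integral v \<xi>) \<le> P * E" if "\<xi> \<in> B" for \<xi>
    proof -
      have "norm (fourier v \<xi>) \<le> E"
        unfolding E_def
      proof (rule continuous_norm_le_Linfty_norm[OF \<open>open B\<close> _ fin that])
        show "continuous_on UNIV (fourier v)"
          using continuous_wave_integral[OF v_sq \<open>compact A\<close> vA] \<open>0 < P\<close>
          unfolding fourier[abs_def] by (intro continuous_on_divide continuous_on_const) auto
      qed
      then show ?thesis using \<open>0 < P\<close> by (simp add: fourier norm_divide field_simps)
    qed
    have semi2: "(sobolev_seminorm m v)\<^sup>2 \<le> \<gamma>\<^sup>2"
      using semi by (intro power_mono) (auto simp: sobolev_seminorm_def sum_nonneg)
    have bound: "(L2_norm v)\<^sup>2 \<le> W (real N) * E\<^sup>2 + 2 * (T / (real N + 1)) ^ (2 * m) * \<gamma>\<^sup>2" for N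
    proof -
      define Y where "Y = 1 + 2 * real D' * (real N + 1)\<^sup>2"
      have "0 < Y" by (simp add: Y_def add_pos_nonneg)
      have "(2 * real N + 1) ^ d \<le> exp (2 * real N) ^ d"
        using exp_ge_add_one_self[of "2 * real N"] by (intro power_mono) linarith+
      also have "\<dots> = exp (2 * real d * real N)" by (simp add: exp_of_nat_mult[symmetric] mult_ac)
      finally have head: "(2 * real N + 1) ^ d \<le> exp (2 * real d * real N)" .
      have "Y ^ (2 * (D * (N + 1))) = exp (ln Y) ^ (2 * (D * (N + 1)))"
        using \<open>0 < Y\<close> by simp
      also have "\<dots> = exp (real (2 * (D * (N + 1))) * ln Y)" by (rule exp_of_nat_mult[symmetric])
      also have "real (2 * (D * (N + 1))) * ln Y = 2 * real D * ((real N + 1) * ln Y)"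
        by (simp add: algebra_simps)
      finally have tail: "Y ^ (2 * (D * (N + 1))) = exp (2 * real D * ((real N + 1) * ln Y))" .
      have "(L2_norm v)\<^sup>2 \<le> C * (2 * real N + 1) ^ d * Y ^ (2 * (D * (N + 1))) * (P * E)\<^sup>2
          + 2 * (T / (real N + 1)) ^ (2 * m) * (sobolev_seminorm m v)\<^sup>2"
        unfolding Y_def by (rule gap[OF v vA small])
      also have "C * (2 * real N + 1) ^ d * Y ^ (2 * (D * (N + 1))) * (P * E)\<^sup>2
          \<le> C * exp (2 * real d * real N) * Y ^ (2 * (D * (N + 1))) * (P * E)\<^sup>2"
        using head \<open>0 < C\<close> \<open>0 < Y\<close> by (intro mult_right_mono mult_left_mono) auto
      also have "\<dots> = W (real N) * E\<^sup>2"
        unfolding tail by (simp add: W_def Y_def power_mult_distrib)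
      also have "2 * (T / (real N + 1)) ^ (2 * m) * (sobolev_seminorm m v)\<^sup>2
          \<le> 2 * (T / (real N + 1)) ^ (2 * m) * \<gamma>\<^sup>2"
        using semi2 by (intro mult_left_mono) (auto simp: zero_le_even_power)
      finally show ?thesis by simp
    qed
    show ?thesis
    proof (cases "E = 0")
      case True
      \<comment> \<open>Only the Sobolev term is left, and the splitting frequency is free.\<close>
      have "(\<lambda>N. T / (real N + 1)) \<longlonglongrightarrow> 0" by real_asymp
      then have "(\<lambda>N. 2 * (T / (real N + 1)) ^ (2 * m) * \<gamma>\<^sup>2) \<longlonglongrightarrow> 2 * 0 ^ (2 * m) * \<gamma>\<^sup>2"
        by (intro tendsto_intros)
      moreover have "2 * 0 ^ (2 * m) * \<gamma>\<^sup>2 = 0" using \<open>0 < m\<close> by simp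
      ultimately have "(\<lambda>N. 2 * (T / (real N + 1)) ^ (2 * m) * \<gamma>\<^sup>2) \<longlonglongrightarrow> 0" by (simp only:)
      moreover have "(L2_norm v)\<^sup>2 \<le> 2 * (T / (real N + 1)) ^ (2 * m) * \<gamma>\<^sup>2" for N
        using bound[of N] True by simp
      ultimately have "(L2_norm v)\<^sup>2 \<le> 0" by (intro LIMSEQ_le_const) auto
      then have "(\<integral>x. (norm (v x))\<^sup>2 \<partial>lebesgue) = 0"
        by (intro antisym) (simp_all add: L2_norm_def)
      then have "AE x in lebesgue. (norm (v x))\<^sup>2 = 0"
        using integral_nonneg_eq_0_iff_AE[of lebesgue "\<lambda>x. (norm (v x))\<^sup>2"] v_sq
        by (simp add: square_integrable_def)
      then show ?thesis using True E by simp
    next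
      case False
      then have "0 < E" using \<open>0 \<le> E\<close> by simp
      define L where "L = ln (1 / E)"
      have "0 < L" using \<open>0 < E\<close> \<open>E < 1\<close> by (simp add: L_def)
      have EL: "E = exp (- L)" using \<open>0 < E\<close> by (simp add: L_def ln_div)
      \<comment> \<open>The splitting frequency: large enough to make the Sobolev term \<open>O(L\<^sup>-\<^sup>2\<^sup>\<mu>)\<close>, small enough for the growth at frequency \<open>N\<close> to be absorbed.\<close>
      define N where "N = nat \<lfloor>L powr \<kappa>\<rfloor>"
      have N: "real N \<le> L powr \<kappa>" "L powr \<kappa> \<le> real N + 1"
        unfolding N_def using powr_ge_zero[of L \<kappa>] by linarith+
      have "W (real N) * E\<^sup>2 = (W (real N) * exp (- 2 * L) * L powr (2 * \<mu>)) * L powr (- (2 * \<mu>))"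
        using \<open>0 < L\<close> by (simp add: EL exp_double[symmetric] powr_minus)
      also have "\<dots> \<le> M * L powr (- (2 * \<mu>))"
        using M[OF \<open>0 < L\<close> _ N(1)] by (intro mult_right_mono) auto
      finally have low: "W (real N) * E\<^sup>2 \<le> M * L powr (- (2 * \<mu>))" .
      have "L powr (2 * \<mu>) = (L powr \<kappa>) ^ (2 * m)"
        using \<open>0 < L\<close> by (simp add: powr_power \<kappa>(3)[symmetric] mult_ac)
      also have "\<dots> \<le> (real N + 1) ^ (2 * m)" using N(2) by (intro power_mono) auto
      finally have "(T / (real N + 1)) ^ (2 * m) \<le> T ^ (2 * m) / L powr (2 * \<mu>)"
        using \<open>0 < L\<close> \<open>0 < T\<close> unfolding power_divide by (intro divide_left_mono) auto
      then have "(T / (real N + 1)) ^ (2 * m) \<le> T ^ (2 * m) * L powr (- (2 * \<mu>))"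
        by (simp add: powr_minus divide_inverse)
      then have high: "2 * (T / (real N + 1)) ^ (2 * m) * \<gamma>\<^sup>2 \<le> 2 * (T ^ (2 * m) * L powr (- (2 * \<mu>))) * \<gamma>\<^sup>2"
        by (intro mult_right_mono mult_left_mono) auto
      have "(L2_norm v)\<^sup>2 \<le> M * L powr (- (2 * \<mu>)) + 2 * (T ^ (2 * m) * L powr (- (2 * \<mu>))) * \<gamma>\<^sup>2"
        using bound[of N] low high by linarith
      also have "\<dots> = c\<^sup>2 * L powr (- (2 * \<mu>))" by (simp add: c2 algebra_simps)
      also have "L powr (- (2 * \<mu>)) = (L powr (- \<mu>))\<^sup>2"
        using \<open>0 < L\<close> by (simp add: powr_power mult.commute)
      finally have "(L2_norm v)\<^sup>2 \<le> (c * L powr (- \<mu>))\<^sup>2" by (simp add: power_mult_distrib)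
      then have "L2_norm v \<le> c * L powr (- \<mu>)"
        by (rule power2_le_imp_le) (use \<open>0 < c\<close> in simp)
      then show ?thesis using False E \<open>0 \<le> E\<close> by (simp add: L_def E_def[symmetric])
    qed
  qed
  show ?thesis
    using \<open>0 < c\<close> claim by blast
qed

end
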